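(* Let $\phi \in L^1(\mathbb{R}_+)$ with $\int_0^\infty \phi(x)\,dx = 1$. Then the summability method $S_{\phi}^*$ is equivalent to the summability method $K$ if and only if the closed ideal generated by $\phi^*$ in $L^1(\mathbb{R})$ is the whole space $L^1(\mathbb{R})$.
   Context: $\mathbb{R}_+ = [0,\infty)$ with Lebesgue measure; functions are complex-valued. For $f \in L^{\infty}(\mathbb{R}_+)$: $K(f) = \alpha$ means that $f(\cdot + s)$ converges, as $s\to\infty$, to the constant $\alpha$ in the weak* topology of $L^{\infty}(\mathbb{R}_+) = L^1(\mathbb{R}_+)^*$; $\mathcal{D}(K)$ is the set of $f$ for which such a constant weak* limit exists. $S^*_{\phi}(f) = \lim_{x\to\infty}\int_x^{\infty} f(t)\phi(t-x)\,dt$, with domain the set of $f \in L^\infty(\mathbb{R}_+)$ for which the limit exists. $S$ is stronger than $S'$ if $\mathcal{D}(S') \subseteq \mathcal{D}(S)$ and $S = S'$ on $\mathcal{D}(S')$; equivalent if each is stronger than the other. $\phi^* \in L^1(\mathbb{R})$ is defined by $\phi^*(x) = 0$ for $x \ge 0$ and $\phi^*(x) = \phi(-x)$ for $x < 0$. $L^1(\mathbb{R})$ is the Banach algebra under convolution $(f*g)(x) = \int_{-\infty}^\infty f(x-t)g(t)\,dt$. *)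

theory Defs
  imports "HOL-Analysis.Analysis"
begin

text \<open>Functions on R_+ = [0,oo) are represented as functions real => complex;
  only their values on {0..} matter.\<close>

definition Linf_Rplus :: "(real \<Rightarrow> complex) \<Rightarrow> bool" where
  "Linf_Rplus f \<longleftrightarrow> set_borel_measurable lborel {0..} f \<and>
     (\<exists>C. AE x in lborel. x \<ge> 0 \<longrightarrow> norm (f x) \<le> C)"

definition L1_Rplus :: "(real \<Rightarrow> complex) \<Rightarrow> bool" where
  "L1_Rplus g \<longleftrightarrow> set_integrable lborel {0..} g"

text \<open>Weak* convergence of the translates f(. + s) to the constant alpha
  in L^oo(R_+) = L^1(R_+)^*.\<close>
definition K_conv :: "(real \<Rightarrow> complex) \<Rightarrow> complex \<Rightarrow> bool" where
  "K_conv f \<alpha> \<longleftrightarrow> (\<forall>g. L1_Rplus g \<longrightarrow>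
     ((\<lambda>s. LINT t:{0..}|lborel. f (t + s) * g t)
        \<longlongrightarrow> \<alpha> * (LINT t:{0..}|lborel. g t)) at_top)"

definition K_dom :: "(real \<Rightarrow> complex) set" where
  "K_dom = {f. Linf_Rplus f \<and> (\<exists>\<alpha>. K_conv f \<alpha>)}"

definition K_val :: "(real \<Rightarrow> complex) \<Rightarrow> complex" where
  "K_val f = (THE \<alpha>. K_conv f \<alpha>)"

definition S_fun :: "(real \<Rightarrow> complex) \<Rightarrow> (real \<Rightarrow> complex) \<Rightarrow> real \<Rightarrow> complex" where
  "S_fun \<phi> f x = (LINT t:{x..}|lborel. f t * \<phi> (t - x))"

definition S_dom :: "(real \<Rightarrow> complex) \<Rightarrow> (real \<Rightarrow> complex) set" where
  "S_dom \<phi> = {f. Linf_Rplus f \<and> (\<exists>\<alpha>. (S_fun \<phi> f \<longlongrightarrow> \<alpha>) at_top)}"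

definition S_val :: "(real \<Rightarrow> complex) \<Rightarrow> (real \<Rightarrow> complex) \<Rightarrow> complex" where
  "S_val \<phi> f = Lim at_top (S_fun \<phi> f)"

definition stronger ::
  "'f set \<Rightarrow> ('f \<Rightarrow> 'v) \<Rightarrow> 'f set \<Rightarrow> ('f \<Rightarrow> 'v) \<Rightarrow> bool" where
  "stronger D1 V1 D2 V2 \<longleftrightarrow> D2 \<subseteq> D1 \<and> (\<forall>f\<in>D2. V1 f = V2 f)"

definition equivalent_methods ::
  "'f set \<Rightarrow> ('f \<Rightarrow> 'v) \<Rightarrow> 'f set \<Rightarrow> ('f \<Rightarrow> 'v) \<Rightarrow> bool" where
  "equivalent_methods D1 V1 D2 V2 \<longleftrightarrow> stronger D1 V1 D2 V2 \<and> stronger D2 V2 D1 V1"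

definition phi_star :: "(real \<Rightarrow> complex) \<Rightarrow> real \<Rightarrow> complex" where
  "phi_star \<phi> x = (if x \<ge> 0 then 0 else \<phi> (- x))"

text \<open>L^1(R) as the Banach algebra under convolution; elements are integrable
  functions, closedness is w.r.t. the L^1 (semi)norm, so closed sets are unions of
  a.e.-classes.\<close>
definition L1_R :: "(real \<Rightarrow> complex) set" where
  "L1_R = {g. integrable lborel g}"

definition conv :: "(real \<Rightarrow> complex) \<Rightarrow> (real \<Rightarrow> complex) \<Rightarrow> real \<Rightarrow> complex" where
  "conv f g x = (LINT t|lborel. f (x - t) * g t)"

definition closed_ideal_L1 :: "(real \<Rightarrow> complex) set \<Rightarrow> bool" where
  "closed_ideal_L1 I \<longleftrightarrow> I \<subseteq> L1_R \<and> (\<lambda>x. 0) \<in> I \<and>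
     (\<forall>f\<in>I. \<forall>h\<in>I. (\<lambda>x. f x + h x) \<in> I) \<and>
     (\<forall>c. \<forall>f\<in>I. (\<lambda>x. c * f x) \<in> I) \<and>
     (\<forall>f\<in>I. \<forall>g\<in>L1_R. conv g f \<in> I) \<and>
     (\<forall>g\<in>L1_R. (\<forall>e>0. \<exists>f\<in>I. (LINT x|lborel. norm (g x - f x)) < e) \<longrightarrow> g \<in> I)"

definition closed_ideal_generated :: "(real \<Rightarrow> complex) \<Rightarrow> (real \<Rightarrow> complex) set" where
  "closed_ideal_generated h = \<Inter>{I. closed_ideal_L1 I \<and> h \<in> I}"

end

theory Submission
  imports Defs "HOL-Real_Asymp.Real_Asymp"
begin

text \<open>
  Since \<open>S_fun \<phi> f\<close> is the convolution of f with \<open>phi_star \<phi>\<close>, weak* convergence tested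
  against \<open>\<phi>\<close> shows that the method S is always stronger than K. Conversely, if f * \<open>phi_star \<phi>\<close>
  tends to \<open>\<alpha>\<close> at infinity, the integrable h for which f * h tends to \<open>\<alpha> \<integral>h\<close> form a closed ideal
  containing \<open>phi_star \<phi>\<close>; if that ideal is everything, f is K-convergent.

  If some g lies outside a closed ideal containing \<open>phi_star \<phi>\<close>, duality yields functions
  \<open>f\<^sub>n\<close> bounded by 1 that almost annihilate the translates of \<open>phi_star \<phi>\<close> by \<open>|y| \<le> n\<close> while
  \<open>\<integral> f\<^sub>n g\<close> stays near a fixed d > 0. Only finitely many translates matter for each n, by continuity of
  translation, so Helly's finite-dimensional theorem replaces Hahn-Banach and the identification
  of the dual of \<open>L\<^sup>1\<close>. Placing the (reflected) \<open>f\<^sub>n\<close> far apart on the half line, damped by slowly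
  varying cutoffs, gives a bounded F with S-limit 0 which is not K-convergent to 0.
\<close>

section \<open>Affine substitutions, bounded multipliers and the L1 triangle inequality\<close>

lemma integral_translate:
  fixes f :: "real \<Rightarrow> 'a :: {banach, second_countable_topology}"
  shows "(LINT x|lborel. f (x + y)) = (LINT x|lborel. f x)"
  using lborel_integral_real_affine[of 1 f y] by (simp add: add.commute)

lemma integral_reflect:
  fixes f :: "real \<Rightarrow> 'a :: {banach, second_countable_topology}"
  shows "(LINT x|lborel. f (y - x)) = (LINT x|lborel. f x)"
  using lborel_integral_real_affine[of "-1" f y] by simp

lemma integrable_translate:
  fixes f :: "real \<Rightarrow> 'a :: {banach, second_countable_topology}"
  shows "integrable lborel f \<Longrightarrow> integrable lborel (\<lambda>x. f (x + y))"
  using lborel_integrable_real_affine[of f 1 y] by (simp add: add.commute)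

lemma integrable_reflect:
  fixes f :: "real \<Rightarrow> 'a :: {banach, second_countable_topology}"
  shows "integrable lborel f \<Longrightarrow> integrable lborel (\<lambda>x. f (y - x))"
  using lborel_integrable_real_affine[of f "-1" y] by simp

lemma integrable_bounded_mult:
  fixes f g :: "'a \<Rightarrow> complex"
  assumes "integrable M g" "f \<in> borel_measurable M" "\<And>x. norm (f x) \<le> C"
  shows "integrable M (\<lambda>x. f x * g x)"
proof (rule Bochner_Integration.integrable_bound[where f="\<lambda>x. C * norm (g x)"])
  show "AE x in M. norm (f x * g x) \<le> norm (C * norm (g x))"
    by (intro AE_I2) (metis assms(3) abs_ge_self norm_ge_zero mult_right_mono norm_mult order_trans real_norm_def)
qed (use assms in auto)

lemma norm_integral_bounded_mult:
  fixes f g :: "'a \<Rightarrow> complex"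
  assumes "integrable M g" "f \<in> borel_measurable M" "\<And>x. norm (f x) \<le> C"
  shows "norm (LINT x|M. f x * g x) \<le> C * (LINT x|M. norm (g x))"
proof -
  have "norm (LINT x|M. f x * g x) \<le> (LINT x|M. norm (f x * g x))"
    by (rule integral_norm_bound)
  also have "\<dots> \<le> (LINT x|M. C * norm (g x))"
    by (intro integral_mono integrable_norm integrable_bounded_mult[OF assms])
       (use assms in \<open>auto simp: norm_mult intro!: mult_right_mono\<close>)
  finally show ?thesis by simp
qed

lemma L1_triangle:
  fixes f g h :: "'a \<Rightarrow> 'b :: {banach, second_countable_topology}"
  assumes "integrable M f" "integrable M g" "integrable M h"
  shows "(LINT x|M. norm (f x - h x)) \<le> (LINT x|M. norm (f x - g x)) + (LINT x|M. norm (g x - h x))"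
proof -
  have "(LINT x|M. norm (f x - h x)) \<le> (LINT x|M. norm (f x - g x) + norm (g x - h x))"
    by (intro integral_mono) (use assms in \<open>auto intro: norm_diff_triangle_le\<close>)
  then show ?thesis using assms by simp
qed

section \<open>Continuity of translation in L1\<close>

text \<open>Continuity of the orbit of translates only at \<open>y = 0\<close>; translation
  invariance of the L1 norm turns it into uniform continuity in \<open>y\<close>, and that is how it
  is applied.\<close>

definition translation_continuous :: "(real \<Rightarrow> 'a :: {banach, second_countable_topology}) \<Rightarrow> bool" where
  "translation_continuous f \<longleftrightarrow>
     (\<forall>e>0. \<exists>d>0. \<forall>y. \<bar>y\<bar> < d \<longrightarrow> (LINT x|lborel. norm (f (x + y) - f x)) < e)"

text \<open>Three-epsilon argument: translation is an L1 isometry, so approximating \<open>f\<close>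
  by \<open>h\<close> also approximates the translate of \<open>f\<close> by that of
  \<open>h\<close>, with the same error.\<close>

lemma translation_continuous_approx:
  fixes f :: "real \<Rightarrow> 'a :: {banach, second_countable_topology}"
  assumes f: "integrable lborel f"
    and ap: "\<And>e. e > 0 \<Longrightarrow> \<exists>h. integrable lborel h \<and> translation_continuous h \<and> (LINT x|lborel. norm (f x - h x)) < e"
  shows "translation_continuous f"
  unfolding translation_continuous_def
proof (intro allI impI)
  fix e :: real assume "e > 0"
  then obtain h where h: "integrable lborel h" "translation_continuous h"
    and fh: "(LINT x|lborel. norm (f x - h x)) < e / 3"
    using ap[of "e/3"] by auto
  then obtain d where "d > 0" and d: "\<And>y. \<bar>y\<bar> < d \<Longrightarrow> (LINT x|lborel. norm (h (x + y) - h x)) < e / 3"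
    unfolding translation_continuous_def using \<open>e > 0\<close> by (meson divide_pos_pos zero_less_numeral)
  have "(LINT x|lborel. norm (f (x + y) - f x)) < e" if "\<bar>y\<bar> < d" for y
  proof -
    have 1: "(LINT x|lborel. norm (f (x + y) - h (x + y))) < e / 3"
      using fh integral_translate[of "\<lambda>x. norm (f x - h x)" y] by simp
    have 2: "(LINT x|lborel. norm (h x - f x)) < e / 3"
      using fh by (simp add: norm_minus_commute)
    have "(LINT x|lborel. norm (f (x + y) - f x)) \<le>
        (LINT x|lborel. norm (f (x + y) - h (x + y))) + (LINT x|lborel. norm (h (x + y) - f x))"
      by (intro L1_triangle integrable_translate f h)
    also have "(LINT x|lborel. norm (h (x + y) - f x)) \<le>
        (LINT x|lborel. norm (h (x + y) - h x)) + (LINT x|lborel. norm (h x - f x))"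
      by (intro L1_triangle integrable_translate f h)
    finally show ?thesis using 1 2 d[OF that] by linarith
  qed
  with \<open>d > 0\<close> show "\<exists>d>0. \<forall>y. \<bar>y\<bar> < d \<longrightarrow> (LINT x|lborel. norm (f (x + y) - f x)) < e" by blast
qed

text \<open>For open \<open>U\<close>, a point of \<open>U\<close> stays in \<open>U\<close> under
  small shifts, so dominated convergence shows that only a small part of \<open>U\<close> can leave
  it.\<close>

lemma translation_continuous_open:
  fixes c :: "'a :: {banach, second_countable_topology}"
  assumes U: "open U" "emeasure lborel U < \<infinity>"
  shows "translation_continuous (\<lambda>x. indicator U x *\<^sub>R c)"
proof -
  let ?u = "\<lambda>x. indicator U x :: real"
  have [measurable]: "U \<in> sets borel" using U by auto
  have iu: "integrable lborel ?u" using U by auto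
  \<comment> \<open>\<open>\<Phi> y\<close> is the measure of the part of \<open>U\<close> that the
    shift by \<open>y\<close> moves out of \<open>U\<close>.\<close>
  define \<Phi> where "\<Phi> y = (LINT x|lborel. ?u x * (1 - ?u (x + y)))" for y
  have \<Phi>0: "(\<Phi> \<longlongrightarrow> 0) (at 0)"
  proof -
    have "((\<lambda>y. LINT x|lborel. ?u x * (1 - ?u (x + y))) \<longlongrightarrow> (LINT (x::real)|lborel. 0)) (at 0)"
      unfolding tendsto_at_iff_sequentially comp_def
    proof (intro allI impI)
      fix X :: "nat \<Rightarrow> real"
      assume X: "\<forall>i. X i \<in> UNIV - {0}" "X \<longlonglongrightarrow> 0"
      show "(\<lambda>n. LINT x|lborel. ?u x * (1 - ?u (x + X n))) \<longlonglongrightarrow> (LINT (x::real)|lborel. 0)"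
      proof (rule integral_dominated_convergence[where w="?u"])
        show "AE x in lborel. (\<lambda>n. ?u x * (1 - ?u (x + X n))) \<longlonglongrightarrow> 0"
        proof (intro AE_I2)
          fix x show "(\<lambda>n. ?u x * (1 - ?u (x + X n))) \<longlonglongrightarrow> 0"
          proof (cases "x \<in> U")
            case True
            have "(\<lambda>n. x + X n) \<longlonglongrightarrow> x + 0" by (intro tendsto_intros X)
            then have "\<forall>\<^sub>F n in sequentially. x + X n \<in> U"
              using U True by (simp add: topological_tendstoD)
            then show ?thesis
              by (intro tendsto_eventually) (simp add: eventually_mono)
          qed auto
        qed
        show "AE x in lborel. norm (?u x * (1 - ?u (x + X n))) \<le> ?u x" for n
          by (auto simp: indicator_def)
      qed (use iu in auto)
    qed
    then show ?thesis by (simp add: \<Phi>_def[abs_def])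
  qed
  \<comment> \<open>\<open>U\<close> and its translate have equal finite measure, so their symmetric
    difference has measure twice \<open>\<Phi> y\<close>.\<close>
  have key: "(LINT x|lborel. norm (indicator U (x + y) *\<^sub>R c - indicator U x *\<^sub>R c)) = 2 * norm c * \<Phi> y" for y
  proof -
    have iuy: "integrable lborel (\<lambda>x. ?u (x + y))" using integrable_translate[OF iu] .
    have i2: "integrable lborel (\<lambda>x. ?u x * ?u (x + y))"
      by (rule Bochner_Integration.integrable_bound[OF iu]) (auto simp: indicator_def)
    have "norm (indicator U (x + y) *\<^sub>R c - indicator U x *\<^sub>R c) =
      norm c * ((?u (x + y) + ?u x) - 2 * (?u x * ?u (x + y)))" for x
      by (auto simp: indicator_def)
    then have "(LINT x|lborel. norm (indicator U (x + y) *\<^sub>R c - indicator U x *\<^sub>R c)) =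
      norm c * (((LINT x|lborel. ?u (x + y)) + (LINT x|lborel. ?u x)) - 2 * (LINT x|lborel. ?u x * ?u (x + y)))"
      using iu iuy i2 by simp
    also have "(LINT x|lborel. ?u (x + y)) = (LINT x|lborel. ?u x)" by (rule integral_translate)
    finally show ?thesis using iu i2 by (simp add: \<Phi>_def algebra_simps)
  qed
  show ?thesis
    unfolding translation_continuous_def key
  proof (intro allI impI)
    fix e :: real assume "e > 0"
    have "((\<lambda>y. 2 * norm c * \<Phi> y) \<longlongrightarrow> 2 * norm c * 0) (at 0)"
      by (intro tendsto_intros \<Phi>0)
    from order_tendstoD(2)[OF this, of e] \<open>e > 0\<close>
    obtain d where "d > 0" "\<And>y. y \<noteq> 0 \<Longrightarrow> \<bar>y\<bar> < d \<Longrightarrow> 2 * norm c * \<Phi> y < e"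
      by (auto simp: eventually_at)
    moreover have "2 * norm c * \<Phi> 0 < e"
      using key[of 0] \<open>e > 0\<close> by auto
    ultimately show "\<exists>d>0. \<forall>y. \<bar>y\<bar> < d \<longrightarrow> 2 * norm c * \<Phi> y < e" by metis
  qed
qed

text \<open>Induction over integrable functions. Outer regularity approximates an indicator by that
  of an open set; sums and dominated limits preserve the property.\<close>

lemma integrable_translation_continuous:
  fixes f :: "real \<Rightarrow> 'a :: {banach, second_countable_topology}"
  assumes "integrable lborel f"
  shows "translation_continuous f"
  using assms
proof (induction f rule: integrable_induct)
  case (base A c)
  then have [measurable]: "A \<in> sets borel" by simp
  have iA: "integrable lborel (\<lambda>x. indicator A x *\<^sub>R c)" using base by auto
  show ?case
  proof (rule translation_continuous_approx[OF iA])
    fix e :: real assume "e > 0"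
    \<comment> \<open>The summand 1 keeps the denominator positive when
      \<open>c = 0\<close>.\<close>
    then have "e / (norm c + 1) > 0" by (simp add: add_nonneg_pos)
    then obtain U where U: "open U" "A \<subseteq> U" "emeasure lborel (U - A) < e / (norm c + 1)"
      using outer_regular_lborel[of A] by auto
    then have [measurable]: "U \<in> sets borel" by auto
    have "emeasure lborel U \<le> emeasure lborel A + emeasure lborel (U - A)"
      using U by (subst plus_emeasure) (auto simp: Un_absorb1)
    also have "\<dots> < \<infinity>" using base U(3) by (auto simp: less_top[symmetric] top_unique)
    finally have fU: "emeasure lborel U < \<infinity>" .
    have fD: "emeasure lborel (U - A) < \<infinity>" using U(3) by (auto simp: less_top[symmetric] top_unique)
    have "(LINT x|lborel. norm (indicator A x *\<^sub>R c - indicator U x *\<^sub>R c)) =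
      (LINT x|lborel. norm c * indicator (U - A) x)"
      using U(2) by (intro Bochner_Integration.integral_cong) (auto simp: indicator_def)
    also have "\<dots> = norm c * measure lborel (U - A)" by simp
    also have "measure lborel (U - A) < e / (norm c + 1)"
      using U(3) fD by (simp add: emeasure_eq_ennreal_measure less_top ennreal_less_iff)
    then have "norm c * measure lborel (U - A) \<le> norm c * (e / (norm c + 1))"
      by (intro mult_left_mono) auto
    also have "norm c * (e / (norm c + 1)) < e" using \<open>e > 0\<close> norm_ge_zero[of c]
      by (simp add: divide_less_eq algebra_simps add_pos_nonneg)
    finally have "(LINT x|lborel. norm (indicator A x *\<^sub>R c - indicator U x *\<^sub>R c)) < e" .
    moreover have "integrable lborel (\<lambda>x. indicator U x *\<^sub>R c)" using fU by auto
    ultimately show "\<exists>h. integrable lborel h \<and> translation_continuous h \<and>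
        (LINT x|lborel. norm (indicator A x *\<^sub>R c - h x)) < e"
      using translation_continuous_open[OF U(1) fU] by blast
  qed
next
  case (add f g)
  show ?case unfolding translation_continuous_def
  proof (intro allI impI)
    fix e :: real assume "e > 0"
    then obtain d1 where d1: "d1 > 0" "\<And>y. \<bar>y\<bar> < d1 \<Longrightarrow> (LINT x|lborel. norm (f (x + y) - f x)) < e / 2"
      using add.IH(1) unfolding translation_continuous_def by (meson half_gt_zero)
    obtain d2 where d2: "d2 > 0" "\<And>y. \<bar>y\<bar> < d2 \<Longrightarrow> (LINT x|lborel. norm (g (x + y) - g x)) < e / 2"
      using add.IH(2) \<open>e > 0\<close> unfolding translation_continuous_def by (meson half_gt_zero)
    have "(LINT x|lborel. norm ((f (x + y) + g (x + y)) - (f x + g x))) < e" if "\<bar>y\<bar> < min d1 d2" for y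
    proof -
      note i = add.hyps[THEN integrable_translate, of y] add.hyps
      have "(LINT x|lborel. norm ((f (x + y) + g (x + y)) - (f x + g x)))
        \<le> (LINT x|lborel. norm (f (x + y) - f x) + norm (g (x + y) - g x))"
        by (intro integral_mono) (use i in \<open>auto simp: norm_diff_triangle_ineq\<close>)
      then show ?thesis using d1(2)[of y] d2(2)[of y] that i by simp
    qed
    with d1(1) d2(1) show "\<exists>d>0. \<forall>y. \<bar>y\<bar> < d \<longrightarrow>
        (LINT x|lborel. norm ((f (x + y) + g (x + y)) - (f x + g x))) < e"
      by (intro exI[of _ "min d1 d2"]) auto
  qed
next
  case (lim f s)
  show ?case
  proof (rule translation_continuous_approx[OF lim.hyps(4)])
    fix e :: real assume "e > 0"
    have "(\<lambda>i. LINT x|lborel. norm (f x - s i x)) \<longlonglongrightarrow> (LINT (x::real)|lborel. 0)"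
    \<comment> \<open>The induction principle supplies \<open>s i\<close> bounded by twice
      \<open>norm (f x)\<close>, whence the factor 3.\<close>
    proof (rule integral_dominated_convergence[where w="\<lambda>x. 3 * norm (f x)"])
      show "AE x in lborel. (\<lambda>i. norm (f x - s i x)) \<longlonglongrightarrow> 0"
      proof (intro AE_I2)
        fix x :: real
        have "(\<lambda>i. norm (f x - s i x)) \<longlonglongrightarrow> norm (f x - f x)"
          by (intro tendsto_intros lim.hyps(2)) simp
        then show "(\<lambda>i. norm (f x - s i x)) \<longlonglongrightarrow> 0" by simp
      qed
      show "AE x in lborel. norm (norm (f x - s i x)) \<le> 3 * norm (f x)" for i
      proof (intro AE_I2)
        fix x :: real
        show "norm (norm (f x - s i x)) \<le> 3 * norm (f x)"
          using norm_triangle_ineq4[of "f x" "s i x"] lim.hyps(3)[of x i] by simp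
      qed
    qed (use lim.hyps(1,4) in auto)
    then have "\<forall>\<^sub>F i in sequentially. (LINT x|lborel. norm (f x - s i x)) < e"
      using order_tendstoD(2)[of _ 0 sequentially e] \<open>e > 0\<close> by simp
    then obtain i where "(LINT x|lborel. norm (f x - s i x)) < e"
      by (auto simp: eventually_sequentially)
    then show "\<exists>h. integrable lborel h \<and> translation_continuous h \<and> (LINT x|lborel. norm (f x - h x)) < e"
      using lim.hyps(1) lim.IH by blast
  qed
qed

section \<open>Helly's theorem for bounded functions\<close>

text \<open>A near-minimiser of \<open>\<Sum>j. |\<integral>f k\<^sub>j - p\<^sub>j|\<^sup>2\<close> over the unit ball plays the role of the separating
  hyperplane, so that neither compactness nor completeness is needed.\<close>
lemma Helly_approx:
  fixes k :: "'i \<Rightarrow> 'a \<Rightarrow> complex" and p :: "'i \<Rightarrow> complex"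
  assumes fin: "finite J" and k: "\<And>j. j \<in> J \<Longrightarrow> integrable M (k j)"
    and le: "\<And>c. Re (\<Sum>j\<in>J. c j * p j) \<le> (LINT x|M. norm (\<Sum>j\<in>J. c j * k j x))"
    and e: "e > 0"
  shows "\<exists>f\<in>borel_measurable M. (\<forall>x. norm (f x) \<le> 1) \<and>
           (\<forall>j\<in>J. norm ((LINT x|M. f x * k j x) - p j) < e)"
proof -
  define B where "B = {f \<in> borel_measurable M. \<forall>x. norm (f x :: complex) \<le> 1}"
  define A where "A f j = (LINT x|M. f x * k j x) - p j" for f j
  define E where "E f = (\<Sum>j\<in>J. (norm (A f j))\<^sup>2)" for f
  have Bk: "integrable M (\<lambda>x. f x * k j x)" if "f \<in> B" "j \<in> J" for f j
    using that by (intro integrable_bounded_mult[where C=1] k) (auto simp: B_def)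
  have B0: "(\<lambda>x. 0) \<in> B" by (simp add: B_def)
  have E0: "E f \<ge> 0" for f by (simp add: E_def sum_nonneg)
  have "\<exists>f\<in>B. E f < e\<^sup>2"
  proof (rule ccontr)
    assume "\<not> ?thesis"
    then have Ege: "E f \<ge> e\<^sup>2" if "f \<in> B" for f using that by force
    define m where "m = Inf (E ` B)"
    have bdd: "bdd_below (E ` B)" using E0 by (auto intro: bdd_belowI[of _ 0])
    have m: "m \<le> E f" if "f \<in> B" for f unfolding m_def using that bdd by (auto intro: cInf_lower)
    define D where "D = (\<Sum>j\<in>J. (2 * (LINT x|M. norm (k j x)))\<^sup>2)"
    have D: "D \<ge> 0" by (simp add: D_def sum_nonneg)
    \<comment> \<open>Length of a step inside the convex set \<open>B\<close>. It is so short that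
      the second-order term of \<open>E\<close> is at most \<open>t * e\<^sup>2 / 2\<close>.\<close>
    define t where "t = min 1 (e\<^sup>2 / (2 * (D + 1)))"
    have t: "0 < t" "t \<le> 1" using e D by (auto simp: t_def)
    have "t * D \<le> (e\<^sup>2 / (2 * (D + 1))) * (D + 1)" using D t by (intro mult_mono) (auto simp: t_def)
    also have "\<dots> = e\<^sup>2 / 2"
    proof -
      have "x / (2 * y) * y = x / 2" if "y \<noteq> 0" for x y :: real using that by simp
      from this[of "D + 1" "e\<^sup>2"] D show ?thesis by linarith
    qed
    finally have tD: "t * D \<le> e\<^sup>2 / 2" .
    have "m < m + t * e\<^sup>2" using t e by simp
    then obtain f0 where f0: "f0 \<in> B" "E f0 < m + t * e\<^sup>2"
      using cInf_lessD[of "E ` B" "m + t * e\<^sup>2"] B0 unfolding m_def by blast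
    define a where "a = A f0"
    define G where "G x = (\<Sum>j\<in>J. cnj (a j) * k j x)" for x
    have iG: "integrable M G" unfolding G_def[abs_def] using k by (intro Bochner_Integration.integrable_sum) auto
    \<comment> \<open>First-order optimality. A step of size \<open>t\<close> from \<open>f0\<close>
      towards \<open>f\<close> cannot push \<open>E\<close> below \<open>m\<close>, and
      \<open>f0\<close> exceeds \<open>m\<close> by less than \<open>t * e\<^sup>2\<close>;
      expanding the square bounds the directional derivative from below.\<close>
    have pos: "Re (\<Sum>j\<in>J. cnj (a j) * A f j) > 0" if f: "f \<in> B" for f
    proof -
      define h where "h x = f0 x + complex_of_real t * (f x - f0 x)" for x
      have "h \<in> B" unfolding B_def
      proof (safe)
        show "h \<in> borel_measurable M" using f f0 unfolding h_def[abs_def] B_def by auto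
        fix x
        have "h x = (1 - complex_of_real t) * f0 x + complex_of_real t * f x" by (simp add: h_def algebra_simps)
        then have "norm (h x) \<le> norm (1 - complex_of_real t) * norm (f0 x) + norm (complex_of_real t) * norm (f x)"
          by (metis norm_mult norm_triangle_ineq)
        also have "norm (1 - complex_of_real t) = 1 - t" using t by (metis abs_of_nonneg diff_ge_0_iff_ge norm_of_real of_real_1 of_real_diff)
        also have "(1 - t) * norm (f0 x) + norm (complex_of_real t) * norm (f x) \<le> (1 - t) * 1 + t * 1"
          using t f f0 by (intro add_mono mult_mono) (auto simp: B_def)
        finally show "norm (h x) \<le> 1" by simp
      qed
      have Ah: "A h j = a j + complex_of_real t * (A f j - a j)" if "j \<in> J" for j
      proof -
        have "(LINT x|M. h x * k j x) = (LINT x|M. f0 x * k j x + complex_of_real t * (f x * k j x - f0 x * k j x))"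
          by (simp add: h_def algebra_simps)
        also have "\<dots> = (LINT x|M. f0 x * k j x) + complex_of_real t * ((LINT x|M. f x * k j x) - (LINT x|M. f0 x * k j x))"
          using Bk[OF f that] Bk[OF f0(1) that] by simp
        finally show ?thesis by (simp add: A_def a_def algebra_simps)
      qed
      have sq: "(norm (u + complex_of_real t * v))\<^sup>2 = (norm u)\<^sup>2 + 2 * t * Re (cnj u * v) + t\<^sup>2 * (norm v)\<^sup>2" for u v
        unfolding cmod_power2 by (simp add: algebra_simps power2_eq_square)
      have AD: "(norm (A f j - a j))\<^sup>2 \<le> (2 * (LINT x|M. norm (k j x)))\<^sup>2" if "j \<in> J" for j
      proof (rule power_mono)
        have "norm (LINT x|M. f x * k j x) \<le> 1 * (LINT x|M. norm (k j x))"
             "norm (LINT x|M. f0 x * k j x) \<le> 1 * (LINT x|M. norm (k j x))"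
          using f f0 k[OF that] by (auto intro!: norm_integral_bounded_mult[where C=1, simplified] simp: B_def)
        then show "norm (A f j - a j) \<le> 2 * (LINT x|M. norm (k j x))"
          unfolding A_def a_def using norm_triangle_ineq4[of "LINT x|M. f x * k j x" "LINT x|M. f0 x * k j x"] by simp
      qed simp
      have "E h = (\<Sum>j\<in>J. (norm (a j))\<^sup>2 + 2 * t * Re (cnj (a j) * (A f j - a j)) + t\<^sup>2 * (norm (A f j - a j))\<^sup>2)"
        unfolding E_def using sq Ah by (intro sum.cong) auto
      also have "\<dots> = E f0 + 2 * t * Re (\<Sum>j\<in>J. cnj (a j) * (A f j - a j)) + t\<^sup>2 * (\<Sum>j\<in>J. (norm (A f j - a j))\<^sup>2)"
        by (simp add: E_def a_def sum.distrib sum_distrib_left del: times_complex.sel)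
      also have "(\<Sum>j\<in>J. (norm (A f j - a j))\<^sup>2) \<le> D" unfolding D_def by (intro sum_mono AD)
      finally have h1: "E h \<le> E f0 + 2 * t * Re (\<Sum>j\<in>J. cnj (a j) * (A f j - a j)) + t\<^sup>2 * D" using t by simp
      define R where "R = Re (\<Sum>j\<in>J. cnj (a j) * A f j)"
      have h2: "Re (\<Sum>j\<in>J. cnj (a j) * (A f j - a j)) = R - E f0"
      proof -
        have "Re (cnj z * (w - z)) = Re (cnj z * w) - (norm z)\<^sup>2" for z w
          unfolding cmod_power2 by (simp add: algebra_simps power2_eq_square)
        then show ?thesis by (simp add: R_def E_def a_def sum_subtractf)
      qed
      have "m \<le> E h" using m \<open>h \<in> B\<close> .
      then have "0 < t * (e\<^sup>2 + 2 * (R - E f0) + t * D)"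
        using f0(2) h1 unfolding h2 by (simp add: algebra_simps power2_eq_square)
      then have "0 < e\<^sup>2 + 2 * (R - E f0) + t * D"
        using t by (simp add: zero_less_mult_iff)
      \<comment> \<open>Since \<open>E f0\<close> is at least \<open>e\<^sup>2\<close> and
        \<open>t * D\<close> at most half of that, the last inequality forces
        \<open>R > 0\<close>.\<close>
      moreover have "e\<^sup>2 > 0" using e by simp
      moreover have "0 < r" if "0 < x + 2 * (r - z) + y" "0 < x" "x \<le> z" "y \<le> x / 2" for r x y z :: real
        using that by (simp add: field_simps)
      ultimately show ?thesis using Ege[OF f0(1)] tD unfolding R_def[symmetric] by blast
    qed
    \<comment> \<open>The extremal function for \<open>G\<close>: it gives
      \<open>f x * G x = - norm (G x)\<close>, also where \<open>G x = 0\<close>, as division by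
      zero yields 0. Then \<open>pos\<close> contradicts the hypothesis \<open>le\<close> with
      coefficients \<open>- cnj (a j)\<close>.\<close>
    define f where "f x = - (cnj (G x) / complex_of_real (norm (G x)))" for x
    have [measurable]: "(\<lambda>x. cnj (G x)) \<in> borel_measurable M"
      by (rule measurable_compose[OF borel_measurable_integrable[OF iG]]) (intro borel_measurable_continuous_onI continuous_intros)
    have "f \<in> B" unfolding B_def f_def[abs_def] using iG by (auto simp: norm_divide)
    have "(\<Sum>j\<in>J. cnj (a j) * A f j) = (\<Sum>j\<in>J. (LINT x|M. cnj (a j) * (f x * k j x))) - (\<Sum>j\<in>J. cnj (a j) * p j)"
      by (simp add: A_def right_diff_distrib sum_subtractf)
    also have "(\<Sum>j\<in>J. (LINT x|M. cnj (a j) * (f x * k j x))) = (LINT x|M. (\<Sum>j\<in>J. cnj (a j) * (f x * k j x)))"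
      using Bk[OF \<open>f \<in> B\<close>] by (subst Bochner_Integration.integral_sum) auto
    also have "\<dots> = (LINT x|M. complex_of_real (- norm (G x)))"
    proof (intro Bochner_Integration.integral_cong refl)
      fix x
      have "(\<Sum>j\<in>J. cnj (a j) * (f x * k j x)) = f x * G x"
        by (simp add: G_def sum_distrib_left mult_ac)
      also have "\<dots> = complex_of_real (- norm (G x))"
        unfolding f_def using complex_norm_square[of "G x"]
        by (cases "G x = 0") (simp_all add: divide_simps power2_eq_square mult.commute)
      finally show "(\<Sum>j\<in>J. cnj (a j) * (f x * k j x)) = complex_of_real (- norm (G x))" .
    qed
    also have "\<dots> = complex_of_real (- (LINT x|M. norm (G x)))" by (subst integral_complex_of_real) simp
    finally have "(LINT x|M. norm (G x)) < Re (\<Sum>j\<in>J. - cnj (a j) * p j)"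
      using pos[OF \<open>f \<in> B\<close>] by (simp add: sum_negf)
    also have "\<dots> \<le> (LINT x|M. norm (\<Sum>j\<in>J. - cnj (a j) * k j x))" by (rule le)
    also have "\<dots> = (LINT x|M. norm (G x))" by (simp add: G_def sum_negf)
    finally show False by simp
  qed
  then obtain f where f: "f \<in> B" "E f < e\<^sup>2" by blast
  have "norm (A f j) < e" if "j \<in> J" for j
  proof -
    have "(norm (A f j))\<^sup>2 \<le> E f" unfolding E_def using that fin by (intro member_le_sum) auto
    then have "(norm (A f j))\<^sup>2 < e\<^sup>2" using f by simp
    then show ?thesis using e by (simp add: power_less_imp_less_base)
  qed
  then show ?thesis using f unfolding B_def A_def by blast
qed

section \<open>Convolution and closed ideals\<close>

text \<open>A single Fubini hypothesis for two uses: \<open>r = 1\<close> serves convolution itself,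
  \<open>r = - 1\<close> the pairing of a bounded function with a reflected convolution.\<close>

lemma integrable_convolution_pair:
  fixes f g h :: "real \<Rightarrow> complex" and r c :: real
  assumes g: "integrable lborel g" and h: "integrable lborel h" and r: "\<bar>r\<bar> = 1"
    and f: "f \<in> borel_measurable borel" "\<And>t. norm (f t) \<le> C"
  shows "integrable (lborel \<Otimes>\<^sub>M lborel) (\<lambda>(s, t). f t * (g s * h (c - s + r * t)))"
proof -
  have [measurable]: "g \<in> borel_measurable borel" "h \<in> borel_measurable borel" "f \<in> borel_measurable borel"
    using g h f by auto
  have r0: "r \<noteq> 0" using r by auto
  have ih: "integrable lborel (\<lambda>t. h (c - s + r * t))" for s
    using lborel_integrable_real_affine[OF h r0] .
  have "integrable (lborel \<Otimes>\<^sub>M lborel) (\<lambda>(s, t). g s * h (c - s + r * t))"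
  proof (rule lborel_pair.Fubini_integrable)
    have "(LINT t|lborel. norm (g s * h (c - s + r * t))) = norm (g s) * (LINT t|lborel. norm (h t))" for s
      using lborel_integral_real_affine[OF r0, of "\<lambda>t. norm (h t)" "c - s"] r by (simp add: norm_mult)
    then show "integrable lborel (\<lambda>s. LINT t|lborel. norm (case (s, t) of (s, t) \<Rightarrow> g s * h (c - s + r * t)))"
      using g by simp
    show "AE s in lborel. integrable lborel (\<lambda>t. case (s, t) of (s, t) \<Rightarrow> g s * h (c - s + r * t))"
      using ih by simp
  qed measurable
  then have "integrable (lborel \<Otimes>\<^sub>M lborel) (\<lambda>z. f (snd z) * (case z of (s, t) \<Rightarrow> g s * h (c - s + r * t)))"
    by (rule integrable_bounded_mult) (use f in measurable)
  then show ?thesis by (simp add: case_prod_unfold)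
qed

lemma conv_alt: "conv g h x = (LINT s|lborel. g s * h (x - s))"
  unfolding conv_def using integral_reflect[of "\<lambda>t. g (x - t) * h t" x] by simp

lemma
  assumes g: "integrable lborel g" and h: "integrable lborel h"
  shows integrable_conv: "integrable lborel (conv g h)"
    and integral_conv: "(LINT x|lborel. conv g h x) = (LINT x|lborel. g x) * (LINT x|lborel. h x)"
proof -
  have i: "integrable (lborel \<Otimes>\<^sub>M lborel) (\<lambda>(s, x). g s * h (x - s))"
    using integrable_convolution_pair[OF g h, of 1 "\<lambda>_. 1" 1 0] by (simp add: algebra_simps)
  show "integrable lborel (conv g h)"
    using lborel_pair.integrable_snd[OF i] by (simp add: conv_alt[abs_def])
  have "(LINT x|lborel. conv g h x) = (LINT s|lborel. LINT x|lborel. g s * h (x - s))"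
    unfolding conv_alt by (rule lborel_pair.Fubini_integral[OF i])
  also have "\<dots> = (LINT s|lborel. g s * (LINT x|lborel. h x))"
    using integral_translate[of h "- s" for s] by simp
  finally show "(LINT x|lborel. conv g h x) = (LINT x|lborel. g x) * (LINT x|lborel. h x)" by simp
qed

text \<open>By Fubini, f * (g * h) = g * (f * h) at the point \<open>x\<close>. Averaging over
  \<open>g\<close> on the outside later lets a limit of f * h pass to f * (g * h).\<close>

lemma integral_bounded_conv:
  fixes f g h :: "real \<Rightarrow> complex"
  assumes g: "integrable lborel g" and h: "integrable lborel h"
    and f: "f \<in> borel_measurable borel" "\<And>t. norm (f t) \<le> C"
  shows "(LINT t|lborel. f t * conv g h (x - t)) =
         (LINT s|lborel. g s * (LINT t|lborel. f t * h (x - s - t)))"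
proof -
  have i: "integrable (lborel \<Otimes>\<^sub>M lborel) (\<lambda>(s, t). f t * (g s * h (x - s - t)))"
    using integrable_convolution_pair[OF g h, of "-1" f C x] f by simp
  have "(LINT t|lborel. f t * conv g h (x - t)) = (LINT t|lborel. LINT s|lborel. f t * (g s * h (x - s - t)))"
    unfolding conv_alt by (simp add: algebra_simps)
  also have "\<dots> = (LINT s|lborel. LINT t|lborel. f t * (g s * h (x - s - t)))"
    by (rule lborel_pair.Fubini_integral[OF i])
  also have "\<dots> = (LINT s|lborel. g s * (LINT t|lborel. f t * h (x - s - t)))"
    by (intro Bochner_Integration.integral_cong refl) (simp add: mult.left_commute[of "f _"])
  finally show ?thesis .
qed

text \<open>Convolving with a normalised bump placed next to \<open>- y\<close> averages translates
  of \<open>k\<close> that are all L1-close to the translate by \<open>y\<close>; Minkowski's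
  inequality bounds the distance to the average.\<close>

lemma conv_approx_translate:
  fixes k :: "real \<Rightarrow> complex"
  assumes k: "integrable lborel k" and e: "e > 0"
  shows "\<exists>g. integrable lborel g \<and> (LINT x|lborel. norm (k (x + y) - conv g k x)) < e"
proof -
  have [measurable]: "k \<in> borel_measurable borel" using k by auto
  obtain d where d: "d > 0" "\<And>z. \<bar>z\<bar> < d \<Longrightarrow> (LINT x|lborel. norm (k (x + z) - k x)) < e / 2"
    using integrable_translation_continuous[OF k] e unfolding translation_continuous_def
    by (meson half_gt_zero)
  \<comment> \<open>As \<open>a < d\<close>, every \<open>s\<close> in the interval carrying
    \<open>g\<close> satisfies \<open>\<bar>y + s\<bar> < d\<close>.\<close>
  define a where "a = d / 2"
  have a: "0 < a" "a < d" using d by (auto simp: a_def)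
  define g where "g s = complex_of_real (indicator {- y..a - y} s / a)" for s
  have [measurable]: "g \<in> borel_measurable borel" by (simp add: g_def[abs_def])
  have ig: "integrable lborel g" unfolding g_def[abs_def] by (intro integrable_of_real integrable_divide_zero) (simp add: emeasure_lborel_Icc_eq)
  have Ig: "(LINT s|lborel. g s) = 1" "(LINT s|lborel. norm (g s)) = 1"
    using a by (simp_all add: g_def norm_divide)
  define \<psi> where "\<psi> s = (LINT x|lborel. norm (k (x + y) - k (x - s)))" for s
  have \<psi>: "\<psi> s < e / 2" if "g s \<noteq> 0" for s
  proof -
    have "\<bar>y + s\<bar> < d" using that a by (auto simp: g_def indicator_def split: if_splits)
    from d(2)[OF this] show ?thesis
      using integral_translate[of "\<lambda>x. norm (k (x + (y + s)) - k x)" "- s"]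
      by (simp add: \<psi>_def algebra_simps)
  qed
  have ikk: "integrable lborel (\<lambda>x. k (x + y) - k (x - s))" for s
    using integrable_translate[OF k, of y] integrable_translate[OF k, of "- s"] by simp
  have g\<psi>: "norm (g s) * \<psi> s \<le> norm (g s) * (e / 2)" for s
    using \<psi>[of s] by (cases "g s = 0") auto
  have \<psi>0: "\<psi> s \<ge> 0" for s by (simp add: \<psi>_def)
  have [measurable]: "\<psi> \<in> borel_measurable borel" unfolding \<psi>_def[abs_def] by measurable
  have ig\<psi>: "integrable lborel (\<lambda>s. norm (g s) * \<psi> s)"
    by (rule Bochner_Integration.integrable_bound[where f="\<lambda>s. norm (g s) * (e / 2)"])
       (use ig g\<psi> \<psi>0 e in auto)
  have i: "integrable (lborel \<Otimes>\<^sub>M lborel) (\<lambda>(s, x). g s * (k (x + y) - k (x - s)))"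
  proof (rule lborel_pair.Fubini_integrable)
    show "integrable lborel (\<lambda>s. LINT x|lborel. norm (case (s, x) of (s, x) \<Rightarrow> g s * (k (x + y) - k (x - s))))"
      using ig\<psi> by (simp add: norm_mult \<psi>_def)
    show "AE s in lborel. integrable lborel (\<lambda>x. case (s, x) of (s, x) \<Rightarrow> g s * (k (x + y) - k (x - s)))"
      using ikk by simp
  qed measurable
  have i2: "integrable (lborel \<Otimes>\<^sub>M lborel) (\<lambda>(s, x). norm (g s * (k (x + y) - k (x - s))))"
    using integrable_norm[OF i] by (simp add: case_prod_unfold)
  have i3: "integrable (lborel \<Otimes>\<^sub>M lborel) (\<lambda>(s, x). g s * k (x - s))"
    using integrable_convolution_pair[OF ig k, of 1 "\<lambda>_. 1" 1 0] by (simp add: algebra_simps)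
  have "(LINT x|lborel. norm (k (x + y) - conv g k x)) \<le>
      (LINT x|lborel. LINT s|lborel. norm (g s * (k (x + y) - k (x - s))))"
  proof (rule integral_mono_AE)
    show "integrable lborel (\<lambda>x. norm (k (x + y) - conv g k x))"
      using integrable_translate[OF k, of y] integrable_conv[OF ig k] by auto
    show "integrable lborel (\<lambda>x. LINT s|lborel. norm (g s * (k (x + y) - k (x - s))))"
      by (rule lborel_pair.integrable_snd[OF i2])
    \<comment> \<open>Splitting the integral needs the section of \<open>g s * k (x - s)\<close> at
      \<open>x\<close> to be integrable, which Fubini grants for almost every
      \<open>x\<close>.\<close>
    show "AE x in lborel. norm (k (x + y) - conv g k x) \<le> (LINT s|lborel. norm (g s * (k (x + y) - k (x - s))))"
      using lborel_pair.AE_integrable_snd[OF i3]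
    proof eventually_elim
      case (elim x)
      have "k (x + y) - conv g k x = (LINT s|lborel. g s * k (x + y)) - (LINT s|lborel. g s * k (x - s))"
        unfolding conv_alt using ig Ig by simp
      also have "\<dots> = (LINT s|lborel. g s * (k (x + y) - k (x - s)))"
        using ig elim by (subst Bochner_Integration.integral_diff[symmetric]) (auto simp: right_diff_distrib)
      finally show ?case by (metis integral_norm_bound)
    qed
  qed
  also have "\<dots> = (LINT s|lborel. LINT x|lborel. norm (g s * (k (x + y) - k (x - s))))"
    by (rule lborel_pair.Fubini_integral[OF i2])
  also have "\<dots> = (LINT s|lborel. norm (g s) * \<psi> s)"
    by (simp add: norm_mult \<psi>_def)
  also have "\<dots> \<le> (LINT s|lborel. norm (g s) * (e / 2))"
    using ig\<psi> ig g\<psi> by (intro integral_mono) auto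
  also have "\<dots> = e / 2" using Ig by simp
  finally have "(LINT x|lborel. norm (k (x + y) - conv g k x)) < e" using e by simp
  with ig show ?thesis by blast
qed

section \<open>Closure properties and translation invariance of closed ideals\<close>

lemma
  assumes "closed_ideal_L1 I"
  shows closed_ideal_L1_integrable: "f \<in> I \<Longrightarrow> integrable lborel f"
    and closed_ideal_L1_zero: "(\<lambda>x. 0) \<in> I"
    and closed_ideal_L1_add: "f \<in> I \<Longrightarrow> h \<in> I \<Longrightarrow> (\<lambda>x. f x + h x) \<in> I"
    and closed_ideal_L1_cmult: "f \<in> I \<Longrightarrow> (\<lambda>x. c * f x) \<in> I"
    and closed_ideal_L1_conv: "f \<in> I \<Longrightarrow> integrable lborel g \<Longrightarrow> conv g f \<in> I"
    and closed_ideal_L1_closed: "integrable lborel g \<Longrightarrow>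
      (\<And>e. e > 0 \<Longrightarrow> \<exists>f\<in>I. (LINT x|lborel. norm (g x - f x)) < e) \<Longrightarrow> g \<in> I"
  using assms by (auto simp: closed_ideal_L1_def L1_R_def)

lemma closed_ideal_L1_translate:
  assumes I: "closed_ideal_L1 I" and k: "k \<in> I"
  shows "(\<lambda>x. k (x + y)) \<in> I"
proof -
  have ik: "integrable lborel k" using closed_ideal_L1_integrable[OF I k] .
  show ?thesis
  proof (rule closed_ideal_L1_closed[OF I integrable_translate[OF ik]])
    fix e :: real assume "e > 0"
    then show "\<exists>f\<in>I. (LINT x|lborel. norm (k (x + y) - f x)) < e"
      using conv_approx_translate[OF ik, of e y] closed_ideal_L1_conv[OF I k] by blast
  qed
qed

lemma closed_ideal_L1_sum:
  assumes I: "closed_ideal_L1 I" and k: "\<And>j. j \<in> J \<Longrightarrow> k j \<in> I"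
  shows "(\<lambda>x. \<Sum>j\<in>J. c j * k j x) \<in> I"
  using k
proof (induction J rule: infinite_finite_induct)
  case (insert j J)
  then show ?case
    using closed_ideal_L1_add[OF I closed_ideal_L1_cmult[OF I, of "k j" "c j"]] by simp
qed (use closed_ideal_L1_zero[OF I] in simp_all)

lemma closed_ideal_L1_L1_R: "closed_ideal_L1 L1_R"
  using integrable_conv by (auto simp: closed_ideal_L1_def L1_R_def)

section \<open>The two summability methods\<close>

text \<open>Off the half line \<open>f\<close> may be arbitrary, and on it the bound holds only
  almost everywhere. A Borel representative bounded everywhere allows convolution over the whole
  line.\<close>

lemma Linf_Rplus_representative:
  assumes "Linf_Rplus f"
  obtains f' C where "f' \<in> borel_measurable borel" "\<And>x. norm (f' x) \<le> C"
    "AE x in lborel. x \<ge> 0 \<longrightarrow> f x = f' x"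
proof -
  define u where "u x = indicator {0..} x *\<^sub>R f x" for x
  have [measurable]: "u \<in> borel_measurable borel"
    using assms by (simp add: Linf_Rplus_def set_borel_measurable_def u_def[abs_def])
  \<comment> \<open>The bound \<open>max 0 C\<close> also covers the points where \<open>f'\<close>
    is set to 0.\<close>
  obtain C where C: "AE x in lborel. x \<ge> 0 \<longrightarrow> norm (f x) \<le> C"
    using assms by (auto simp: Linf_Rplus_def)
  define f' where "f' x = (if norm (u x) \<le> max 0 C then u x else 0)" for x
  show ?thesis
  proof (rule that[of f' "max 0 C"])
    show "f' \<in> borel_measurable borel" unfolding f'_def[abs_def] by measurable
    show "norm (f' x) \<le> max 0 C" for x by (auto simp: f'_def)
    show "AE x in lborel. x \<ge> 0 \<longrightarrow> f x = f' x"
      using C by eventually_elim (auto simp: f'_def u_def indicator_def)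
  qed
qed

text \<open>Up to the null set containing only 0, where \<open>phi_star g\<close> is 0 by
  definition, \<open>phi_star g\<close> is the reflection of \<open>g\<close> cut off to the half
  line.\<close>

lemma
  assumes "set_integrable lborel {0..} g"
  shows integrable_phi_star: "integrable lborel (phi_star g)"
    and integral_phi_star: "(LINT x|lborel. phi_star g x) = (LINT x:{0..}|lborel. g x)"
proof -
  let ?u = "\<lambda>x. indicator {0..} x *\<^sub>R g x"
  have u: "integrable lborel ?u" using assms by (simp add: set_integrable_def)
  then have [measurable]: "?u \<in> borel_measurable borel" by auto
  have eq: "phi_star g x = indicator {..<0} x *\<^sub>R ?u (0 - x)" for x
    by (auto simp: phi_star_def indicator_def)
  have [measurable]: "phi_star g \<in> borel_measurable borel"
    unfolding eq[abs_def] by measurable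
  have ae: "AE x in lborel. phi_star g x = ?u (0 - x)"
    using AE_lborel_singleton[of "0::real"] by eventually_elim (auto simp: phi_star_def indicator_def)
  have iu: "integrable lborel (\<lambda>x. ?u (0 - x))" by (rule integrable_reflect[OF u])
  show "integrable lborel (phi_star g)"
  proof (rule integrable_cong_AE_imp[OF iu])
    show "AE x in lborel. ?u (0 - x) = phi_star g x" using ae by eventually_elim simp
  qed simp
  have "(LINT x|lborel. phi_star g x) = (LINT x|lborel. ?u (0 - x))"
    by (rule integral_cong_AE) (use ae in auto)
  also have "\<dots> = (LINT x|lborel. ?u x)" by (rule integral_reflect)
  finally show "(LINT x|lborel. phi_star g x) = (LINT x:{0..}|lborel. g x)"
    by (simp add: set_lebesgue_integral_def)
qed

text \<open>Identifies the weak* test integral against \<open>g\<close> with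
  \<open>S_fun g f\<close>, so that K amounts to running the methods of all integrable
  \<open>g\<close> at once.\<close>

lemma S_fun_shift: "S_fun g f s = (LINT t:{0..}|lborel. f (t + s) * g t)"
  unfolding S_fun_def set_lebesgue_integral_def
  using integral_translate[of "\<lambda>t. indicator {s..} t *\<^sub>R (f t * g (t - s))" s, symmetric]
  by (simp add: indicator_def)

lemma K_conv_iff_S_fun:
  "K_conv f \<alpha> \<longleftrightarrow> (\<forall>g. L1_Rplus g \<longrightarrow>
     (S_fun g f \<longlongrightarrow> \<alpha> * (LINT t:{0..}|lborel. g t)) at_top)"
  unfolding K_conv_def S_fun_shift[abs_def] ..

text \<open>For \<open>x \<ge> 0\<close> the integration range lies in the half line, where
  \<open>f\<close> and \<open>f'\<close> agree almost everywhere. The integrands can also differ at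
  \<open>t = x\<close>, because \<open>phi_star g\<close> vanishes at 0.\<close>

lemma S_fun_eq_convolution:
  assumes f: "Linf_Rplus f"
    and f': "f' \<in> borel_measurable borel" "AE x in lborel. x \<ge> 0 \<longrightarrow> f x = f' x"
    and g: "set_integrable lborel {0..} g" and x: "x \<ge> 0"
  shows "S_fun g f x = (LINT t|lborel. f' t * phi_star g (x - t))"
  unfolding S_fun_def set_lebesgue_integral_def
proof (rule integral_cong_AE)
  let ?u = "\<lambda>x. indicator {0..} x *\<^sub>R g x"
  let ?v = "\<lambda>x. indicator {0..} x *\<^sub>R f x"
  have [measurable]: "?u \<in> borel_measurable borel" "?v \<in> borel_measurable borel"
    "f' \<in> borel_measurable borel" "phi_star g \<in> borel_measurable borel"
    using g f f' integrable_phi_star[OF g]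
    by (auto simp: set_integrable_def Linf_Rplus_def set_borel_measurable_def)
  have eq: "indicator {x..} t *\<^sub>R (f t * g (t - x)) = ?v t * ?u (t - x)" for t
    using x by (auto simp: indicator_def)
  show "(\<lambda>t. indicator {x..} t *\<^sub>R (f t * g (t - x))) \<in> borel_measurable lborel"
    unfolding eq by measurable
  show "(\<lambda>t. f' t * phi_star g (x - t)) \<in> borel_measurable lborel" by measurable
  show "AE t in lborel. indicator {x..} t *\<^sub>R (f t * g (t - x)) = f' t * phi_star g (x - t)"
    using f'(2) AE_lborel_singleton[of x]
  proof eventually_elim
    case (elim t)
    then show ?case using x unfolding eq by (auto simp: phi_star_def indicator_def)
  qed
qed

lemma K_conv_imp_S:
  assumes "set_integrable lborel {0..} \<phi>" "(LINT x:{0..}|lborel. \<phi> x) = 1" "K_conv f \<alpha>"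
  shows "(S_fun \<phi> f \<longlongrightarrow> \<alpha>) at_top"
  using assms by (auto simp: K_conv_iff_S_fun L1_Rplus_def)

text \<open>The function \<open>\<phi>\<close> has integral 1, so testing against it recovers the
  weak* limit, which is therefore unique.\<close>

lemma K_val_eq:
  fixes \<phi> :: "real \<Rightarrow> complex"
  assumes "set_integrable lborel {0..} \<phi>" "(LINT x:{0..}|lborel. \<phi> x) = 1" "K_conv f \<alpha>"
  shows "K_val f = \<alpha>"
  unfolding K_val_def
proof (rule the_equality)
  fix \<beta> assume "K_conv f \<beta>"
  from tendsto_unique[OF _ K_conv_imp_S[OF assms(1,2) this] K_conv_imp_S[OF assms]]
  show "\<beta> = \<alpha>" by simp
qed fact

lemma S_val_eq: "(S_fun \<phi> f \<longlongrightarrow> \<alpha>) at_top \<Longrightarrow> S_val \<phi> f = \<alpha>"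
  unfolding S_val_def by (rule tendsto_Lim) simp_all

lemma S_stronger_than_K:
  assumes "set_integrable lborel {0..} \<phi>" "(LINT x:{0..}|lborel. \<phi> x) = 1"
  shows "stronger (S_dom \<phi>) (S_val \<phi>) K_dom K_val"
  unfolding stronger_def S_dom_def K_dom_def
proof (intro conjI subsetI ballI; clarify)
  fix f \<alpha> assume f: "Linf_Rplus f" "K_conv f \<alpha>"
  show "\<exists>\<alpha>. (S_fun \<phi> f \<longlongrightarrow> \<alpha>) at_top"
    using K_conv_imp_S[OF assms f(2)] ..
  show "S_val \<phi> f = K_val f"
    unfolding S_val_eq[OF K_conv_imp_S[OF assms f(2)]] K_val_eq[OF assms f(2)] ..
qed

text \<open>Convolving \<open>h\<close> with \<open>g\<close> averages shifted copies of f * h, all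
  with the same limit, so dominated convergence applies. Closedness follows from the uniform bound
  of f * h by \<open>C\<close> times the L1 norm of \<open>h\<close>.\<close>

lemma closed_ideal_L1_convolution_limit:
  assumes f: "f \<in> borel_measurable borel" "\<And>t. norm (f t) \<le> C"
  shows "closed_ideal_L1 {h. integrable lborel h \<and>
    ((\<lambda>x. LINT t|lborel. f t * h (x - t)) \<longlongrightarrow> \<alpha> * (LINT t|lborel. h t)) at_top}"
    (is "closed_ideal_L1 ?I")
proof -
  have [measurable]: "f \<in> borel_measurable borel" by fact
  have C0: "C \<ge> 0" using f(2)[of 0] norm_ge_zero order_trans by blast
  have ifh: "integrable lborel (\<lambda>t. f t * h (x - t))" if "integrable lborel h" for h x
    using f by (intro integrable_bounded_mult[where C=C] integrable_reflect[OF that]) auto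
  have nfh: "norm (LINT t|lborel. f t * h (x - t)) \<le> C * (LINT t|lborel. norm (h t))"
    if "integrable lborel h" for h x
    using norm_integral_bounded_mult[OF integrable_reflect[OF that, of x], of f C]
      integral_reflect[of "\<lambda>t. norm (h t)" x] f by simp
  have add: "(\<lambda>x. g x + h x) \<in> ?I" if "g \<in> ?I" "h \<in> ?I" for g h
  proof -
    from that have i: "integrable lborel g" "integrable lborel h" by auto
    have "((\<lambda>x. (LINT t|lborel. f t * g (x - t)) + (LINT t|lborel. f t * h (x - t)))
        \<longlongrightarrow> \<alpha> * (LINT t|lborel. g t) + \<alpha> * (LINT t|lborel. h t)) at_top"
      using that by (intro tendsto_add) auto
    then show ?thesis using i ifh by (simp add: distrib_left)
  qed
  have cmult: "(\<lambda>x. c * h x) \<in> ?I" if "h \<in> ?I" for c h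
  proof -
    from that have i: "integrable lborel h" by auto
    have "((\<lambda>x. c * (LINT t|lborel. f t * h (x - t))) \<longlongrightarrow> c * (\<alpha> * (LINT t|lborel. h t))) at_top"
      using that by (intro tendsto_mult_left) auto
    then show ?thesis using i by (simp add: mult.left_commute[of _ c])
  qed
  have cnv: "conv g h \<in> ?I" if h: "h \<in> ?I" and g: "g \<in> L1_R" for g h
  proof -
    have ih: "integrable lborel h" and ig: "integrable lborel g" using h g by (auto simp: L1_R_def)
    have [measurable]: "h \<in> borel_measurable borel" "g \<in> borel_measurable borel" using ih ig by auto
    have "((\<lambda>x. LINT s|lborel. g s * (LINT t|lborel. f t * h (x - s - t)))
       \<longlongrightarrow> (LINT s|lborel. g s * (\<alpha> * (LINT t|lborel. h t)))) at_top"
    proof (rule integral_dominated_convergence_at_top[where w="\<lambda>s. norm (g s) * (C * (LINT t|lborel. norm (h t)))"])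
      show "AE s in lborel. ((\<lambda>x. g s * (LINT t|lborel. f t * h (x - s - t))) \<longlongrightarrow>
          g s * (\<alpha> * (LINT t|lborel. h t))) at_top"
      proof (intro AE_I2 tendsto_mult_left)
        fix s :: real
        have "filterlim (\<lambda>x. - s + x) at_top at_top"
          by (rule filterlim_tendsto_add_at_top[OF tendsto_const filterlim_ident])
        moreover have "((\<lambda>x. LINT t|lborel. f t * h (x - t)) \<longlongrightarrow> \<alpha> * (LINT t|lborel. h t)) at_top"
          using h by auto
        ultimately show "((\<lambda>x. LINT t|lborel. f t * h (x - s - t)) \<longlongrightarrow> \<alpha> * (LINT t|lborel. h t)) at_top"
          using filterlim_compose[of "\<lambda>x. LINT t|lborel. f t * h (x - t)" _ at_top "\<lambda>x. - s + x" at_top] by simp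
      qed
      show "\<forall>\<^sub>F x in at_top. AE s in lborel. norm (g s * (LINT t|lborel. f t * h (x - s - t))) \<le>
          norm (g s) * (C * (LINT t|lborel. norm (h t)))"
        using nfh[OF ih] by (auto simp: norm_mult intro!: always_eventually mult_left_mono)
    qed (use ig in auto)
    then show ?thesis
      using integrable_conv[OF ig ih] integral_conv[OF ig ih] integral_bounded_conv[OF ig ih f]
      by (simp add: mult.left_commute)
  qed
  have closed: "g \<in> ?I" if g: "g \<in> L1_R"
    and ap: "\<forall>e>0. \<exists>h\<in>?I. (LINT x|lborel. norm (g x - h x)) < e" for g
  proof -
    have ig: "integrable lborel g" using g by (simp add: L1_R_def)
    have "((\<lambda>x. LINT t|lborel. f t * g (x - t)) \<longlongrightarrow> \<alpha> * (LINT t|lborel. g t)) at_top"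
    proof (rule tendstoI)
      fix e :: real assume e: "e > 0"
      \<comment> \<open>Replacing \<open>g\<close> by \<open>h\<close> costs \<open>C\<close> times
        the L1 distance in the convolution and \<open>norm \<alpha>\<close> times it in the limit;
        the 1 makes \<open>D\<close> positive.\<close>
      define D where "D = C + norm \<alpha> + 1"
      have D: "D > 0" using C0 by (simp add: D_def add_nonneg_pos)
      then obtain h where h: "h \<in> ?I" and gh: "(LINT x|lborel. norm (g x - h x)) < e / 2 / D"
        using ap e by (meson divide_pos_pos half_gt_zero)
      then have ih: "integrable lborel h" by auto
      have "\<forall>\<^sub>F x in at_top. dist (LINT t|lborel. f t * h (x - t)) (\<alpha> * (LINT t|lborel. h t)) < e / 2"
        using h e by (intro tendstoD) auto
      then show "\<forall>\<^sub>F x in at_top. dist (LINT t|lborel. f t * g (x - t)) (\<alpha> * (LINT t|lborel. g t)) < e"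
      proof eventually_elim
        case (elim x)
        let ?N = "LINT x|lborel. norm (g x - h x)"
        have 1: "norm ((LINT t|lborel. f t * g (x - t)) - (LINT t|lborel. f t * h (x - t))) \<le> C * ?N"
          using nfh[of "\<lambda>t. g t - h t" x] ig ih ifh by (simp add: right_diff_distrib)
        have "norm ((LINT t|lborel. h t) - (LINT t|lborel. g t)) \<le> ?N"
          using integral_norm_bound[of lborel "\<lambda>t. h t - g t"] ig ih by (simp add: norm_minus_commute)
        then have 2: "norm (\<alpha> * (LINT t|lborel. h t) - \<alpha> * (LINT t|lborel. g t)) \<le> norm \<alpha> * ?N"
          unfolding right_diff_distrib[symmetric] norm_mult by (intro mult_left_mono) auto
        have N0: "?N \<ge> 0" by simp
        have "D * ?N \<le> e / 2" using gh D by (simp add: field_simps)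
        moreover have "C * ?N + norm \<alpha> * ?N \<le> D * ?N" using N0 by (simp add: D_def distrib_right)
        ultimately have 3: "C * ?N + norm \<alpha> * ?N \<le> e / 2" by linarith
        have "norm ((LINT t|lborel. f t * g (x - t)) - \<alpha> * (LINT t|lborel. g t)) \<le>
          norm ((LINT t|lborel. f t * g (x - t)) - (LINT t|lborel. f t * h (x - t))) +
          (norm ((LINT t|lborel. f t * h (x - t)) - \<alpha> * (LINT t|lborel. h t)) +
           norm (\<alpha> * (LINT t|lborel. h t) - \<alpha> * (LINT t|lborel. g t)))"
          by (meson norm_diff_triangle_le order_refl)
        with 1 2 3 elim show ?case unfolding dist_norm by linarith
      qed
    qed
    with ig show ?thesis by simp
  qed
  show ?thesis
    unfolding closed_ideal_L1_def
  proof (intro conjI ballI allI impI)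
    show "?I \<subseteq> L1_R" by (auto simp: L1_R_def)
    show "(\<lambda>x. 0) \<in> ?I" by simp
  qed (fact add cmult cnv closed)+
qed

lemma S_limit_imp_K_conv:
  assumes \<phi>: "set_integrable lborel {0..} \<phi>" "(LINT x:{0..}|lborel. \<phi> x) = 1"
    and gen: "closed_ideal_generated (phi_star \<phi>) = L1_R"
    and f: "Linf_Rplus f" and lim: "(S_fun \<phi> f \<longlongrightarrow> \<alpha>) at_top"
  shows "K_conv f \<alpha>"
proof -
  obtain f' C where f': "f' \<in> borel_measurable borel" "\<And>x. norm (f' x) \<le> C"
    "AE x in lborel. x \<ge> 0 \<longrightarrow> f x = f' x"
    using Linf_Rplus_representative[OF f] by metis
  define I where "I = {h. integrable lborel h \<and>
    ((\<lambda>x. LINT t|lborel. f' t * h (x - t)) \<longlongrightarrow> \<alpha> * (LINT t|lborel. h t)) at_top}"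
  have ev: "\<forall>\<^sub>F x in at_top. S_fun g f x = (LINT t|lborel. f' t * phi_star g (x - t))"
    if "set_integrable lborel {0..} g" for g
    by (rule eventually_mono[OF eventually_ge_at_top[of 0]]) (rule S_fun_eq_convolution[OF f f'(1,3) that])
  have "closed_ideal_L1 I"
    unfolding I_def by (rule closed_ideal_L1_convolution_limit[OF f'(1,2)])
  \<comment> \<open>Since \<open>phi_star \<phi>\<close> has integral 1, the given limit
    \<open>\<alpha>\<close> is exactly the one that membership demands.\<close>
  moreover have "phi_star \<phi> \<in> I"
    using integrable_phi_star[OF \<phi>(1)] integral_phi_star[OF \<phi>(1)] \<phi>(2) lim
    by (simp add: I_def tendsto_cong[OF ev[OF \<phi>(1)]])
  ultimately have "L1_R \<subseteq> I" unfolding gen[symmetric] closed_ideal_generated_def by blast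
  show ?thesis unfolding K_conv_iff_S_fun
  proof (intro allI impI)
    fix g assume "L1_Rplus g"
    then have g: "set_integrable lborel {0..} g" by (simp add: L1_Rplus_def)
    then have "phi_star g \<in> I" using \<open>L1_R \<subseteq> I\<close> integrable_phi_star by (auto simp: L1_R_def)
    then show "(S_fun g f \<longlongrightarrow> \<alpha> * (LINT t:{0..}|lborel. g t)) at_top"
      by (simp add: I_def tendsto_cong[OF ev[OF g]] integral_phi_star[OF g])
  qed
qed

section \<open>The gluing construction\<close>

text \<open>Translates of \<open>k\<close> stay in \<open>I\<close>, so \<open>g\<close> has
  distance at least \<open>d\<close> from their span. This is the norm inequality required by
  \<open>Helly_approx\<close> for the targets 0 on the translates and \<open>d\<close> on
  \<open>g\<close>.\<close>

lemma almost_annihilator: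
  assumes I: "closed_ideal_L1 I" and k: "k \<in> I" and g: "integrable lborel g"
    and d: "d > 0" "\<And>f. f \<in> I \<Longrightarrow> d \<le> (LINT x|lborel. norm (g x - f x))"
    and e: "e > 0"
  shows "\<exists>f\<in>borel_measurable borel. (\<forall>x. norm (f x) \<le> 1) \<and>
    (\<forall>y. \<bar>y\<bar> \<le> R \<longrightarrow> norm (LINT x|lborel. f x * k (x + y)) < e) \<and>
    norm ((LINT x|lborel. f x * g x) - complex_of_real d) < e"
proof -
  have ik: "integrable lborel k" by (rule closed_ideal_L1_integrable[OF I k])
  obtain h where h: "h > 0" "\<And>z. \<bar>z\<bar> < h \<Longrightarrow> (LINT x|lborel. norm (k (x + z) - k x)) < e / 2"
    using integrable_translation_continuous[OF ik] e unfolding translation_continuous_def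
    by (meson half_gt_zero)
  \<comment> \<open>A finite net of shifts: between a shift and a nearby net point, the translates
    of \<open>k\<close> differ by less than \<open>e / 2\<close> in L1.\<close>
  obtain Y where Y: "finite Y" "{-R..R} \<subseteq> (\<Union>y\<in>Y. ball y h)"
    using compact_Icc[of "-R" R] h(1) unfolding compact_eq_totally_bounded by blast
  \<comment> \<open>The index \<open>None\<close> stands for \<open>g\<close>, and
    \<open>Some y\<close> for the translate of \<open>k\<close> by the net point
    \<open>y\<close>.\<close>
  define J where "J = insert None (Some ` Y)"
  define \<kappa> where "\<kappa> j x = (case j of None \<Rightarrow> g x | Some y \<Rightarrow> k (x + y))" for j x
  define p where "p j = (case j of None \<Rightarrow> complex_of_real d | Some (y::real) \<Rightarrow> 0)" for j
  have sumJ: "(\<Sum>j\<in>J. F j) = F None + (\<Sum>y\<in>Y. F (Some y))" for F :: "real option \<Rightarrow> complex"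
    using Y(1) unfolding J_def by (subst sum.insert) (auto simp: sum.reindex)
  have "\<exists>f\<in>borel_measurable lborel. (\<forall>x. norm (f x) \<le> 1) \<and>
           (\<forall>j\<in>J. norm ((LINT x|lborel. f x * \<kappa> j x) - p j) < e / 2)"
  proof (rule Helly_approx)
    show "finite J" using Y(1) by (simp add: J_def)
    show "integrable lborel (\<kappa> j)" for j
      using g integrable_translate[OF ik] by (cases j) (auto simp: \<kappa>_def[abs_def])
    fix c
    show "Re (\<Sum>j\<in>J. c j * p j) \<le> (LINT x|lborel. norm (\<Sum>j\<in>J. c j * \<kappa> j x))"
    proof (cases "c None = 0")
      case True
      then show ?thesis by (simp add: sumJ p_def)
    next
      case False
      \<comment> \<open>Factoring out \<open>c None\<close> turns the combination into
        \<open>g\<close> minus an element of \<open>I\<close>, to which the distance bound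
        applies.\<close>
      define f where "f x = (\<Sum>y\<in>Y. (- c (Some y) / c None) * k (x + y))" for x
      have "f \<in> I" unfolding f_def[abs_def]
        by (rule closed_ideal_L1_sum[OF I]) (rule closed_ideal_L1_translate[OF I k])
      have "(\<Sum>j\<in>J. c j * \<kappa> j x) = c None * (g x - f x)" for x
        using False by (simp add: sumJ \<kappa>_def f_def right_diff_distrib distrib_left sum_distrib_left sum_negf)
      then have "(LINT x|lborel. norm (\<Sum>j\<in>J. c j * \<kappa> j x)) = norm (c None) * (LINT x|lborel. norm (g x - f x))"
        by (simp add: norm_mult)
      moreover have "Re (\<Sum>j\<in>J. c j * p j) \<le> norm (c None) * d"
        using complex_Re_le_cmod[of "c None * complex_of_real d"] d(1) by (simp add: sumJ p_def norm_mult)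
      ultimately show ?thesis
        using mult_left_mono[OF d(2)[OF \<open>f \<in> I\<close>], of "norm (c None)"] by simp
    qed
  qed (use e in simp)
  then obtain f where f: "f \<in> borel_measurable borel" "\<And>x. norm (f x) \<le> 1"
    and fJ: "\<And>j. j \<in> J \<Longrightarrow> norm ((LINT x|lborel. f x * \<kappa> j x) - p j) < e / 2"
    by auto
  have fg: "norm ((LINT x|lborel. f x * g x) - complex_of_real d) < e"
    using fJ[of None] e by (simp add: J_def \<kappa>_def p_def)
  have "norm (LINT x|lborel. f x * k (x + y)) < e" if "\<bar>y\<bar> \<le> R" for y
  proof -
    have "y \<in> {-R..R}" using that by auto
    then obtain z where z: "z \<in> Y" "\<bar>y - z\<bar> < h" using Y(2) by (force simp: dist_real_def abs_minus_commute)
    have 1: "norm (LINT x|lborel. f x * k (x + z)) < e / 2"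
      using fJ[of "Some z"] z(1) by (simp add: J_def \<kappa>_def p_def)
    have i: "integrable lborel (\<lambda>x. f x * k (x + w))" for w
      using f by (intro integrable_bounded_mult[where C=1] integrable_translate[OF ik]) auto
    have "norm (LINT x|lborel. f x * (k (x + y) - k (x + z))) \<le> 1 * (LINT x|lborel. norm (k (x + y) - k (x + z)))"
      using f by (intro norm_integral_bounded_mult Bochner_Integration.integrable_diff integrable_translate ik) auto
    also have "(LINT x|lborel. norm (k (x + y) - k (x + z))) = (LINT x|lborel. norm (k (x + (y - z)) - k x))"
      using integral_translate[of "\<lambda>x. norm (k (x + (y - z)) - k x)" z] by simp
    also have "\<dots> < e / 2" by (rule h(2)[OF z(2)])
    finally have "norm ((LINT x|lborel. f x * k (x + y)) - (LINT x|lborel. f x * k (x + z))) < e / 2"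
      using i by (simp add: right_diff_distrib)
    with 1 show ?thesis
      using norm_triangle_sub[of "LINT x|lborel. f x * k (x + y)" "LINT x|lborel. f x * k (x + z)"] by linarith
  qed
  with f fg show ?thesis by blast
qed

text \<open>The function \<open>glue f\<close> carries on the block \<open>[n\<^sup>2, (n + 1)\<^sup>2)\<close> the reflection of \<open>f n\<close> about the block
  centre, damped by a tent supported in the middle half of the block. Neighbouring tents are thus
  separated by gaps of length at least n. Note that \<open>tent 0\<close> is constantly 1, since \<open>x / 0 = 0\<close>.\<close>
definition tent :: "nat \<Rightarrow> real \<Rightarrow> real" where
  "tent n u = max 0 (1 - 2 * \<bar>u\<bar> / real n)"

definition block_index :: "real \<Rightarrow> nat" where
  "block_index t = nat \<lfloor>sqrt t\<rfloor>"

definition block_center :: "nat \<Rightarrow> real" where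
  "block_center n = (real n)\<^sup>2 + real n"

definition glue :: "(nat \<Rightarrow> real \<Rightarrow> complex) \<Rightarrow> real \<Rightarrow> complex" where
  "glue f t = (let n = block_index t in
     complex_of_real (tent n (t - block_center n)) * f n (block_center n - t))"

lemma tent_bounds: "0 \<le> tent n u" "tent n u \<le> 1"
  by (auto simp: tent_def)

lemma tent_eq_0: "real n \<le> 2 * \<bar>u\<bar> \<Longrightarrow> n > 0 \<Longrightarrow> tent n u = 0"
  by (simp add: tent_def field_simps)

text \<open>The slope decays like \<open>2 / n\<close>, so on a window of fixed length the cutoff is
  almost constant far out.\<close>

lemma tent_lipschitz: "\<bar>tent n u - tent n v\<bar> \<le> 2 * \<bar>u - v\<bar> / real n"
proof -
  have "\<bar>tent n u - tent n v\<bar> \<le> \<bar>2 * \<bar>u\<bar> / real n - 2 * \<bar>v\<bar> / real n\<bar>"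
    unfolding tent_def by linarith
  also have "\<dots> = 2 * \<bar>\<bar>u\<bar> - \<bar>v\<bar>\<bar> / real n"
  proof -
    have "2 * \<bar>u\<bar> / real n - 2 * \<bar>v\<bar> / real n = 2 * (\<bar>u\<bar> - \<bar>v\<bar>) / real n"
      by (simp add: diff_divide_distrib)
    then show ?thesis by (simp only: abs_divide abs_mult abs_numeral abs_of_nat)
  qed
  also have "\<dots> \<le> 2 * \<bar>u - v\<bar> / real n" by (intro divide_right_mono) auto
  finally show ?thesis .
qed

lemma block_index_eq:
  assumes "(real n)\<^sup>2 \<le> t" "t < (real n + 1)\<^sup>2"
  shows "block_index t = n"
proof -
  have "real n \<le> sqrt t" using assms(1) by (simp add: real_le_rsqrt)
  moreover have "sqrt t < real n + 1" using assms(2) by (intro real_less_lsqrt) auto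
  ultimately have "\<lfloor>sqrt t\<rfloor> = int n" by (intro floor_unique) auto
  then show ?thesis by (simp add: block_index_def)
qed

lemma block_index_bounds:
  assumes "t \<ge> 0"
  shows "(real (block_index t))\<^sup>2 \<le> t" "t < (real (block_index t) + 1)\<^sup>2"
proof -
  have n: "real (block_index t) = of_int \<lfloor>sqrt t\<rfloor>" using assms by (simp add: block_index_def)
  have "(real (block_index t))\<^sup>2 \<le> (sqrt t)\<^sup>2" unfolding n using assms by (intro power_mono) auto
  then show "(real (block_index t))\<^sup>2 \<le> t" using assms by simp
  have "(sqrt t)\<^sup>2 < (real (block_index t) + 1)\<^sup>2"
    unfolding n using assms by (intro power_strict_mono) auto
  then show "t < (real (block_index t) + 1)\<^sup>2" using assms by simp
qed

lemma glue_measurable [measurable]: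
  assumes "\<And>n. f n \<in> borel_measurable borel"
  shows "glue f \<in> borel_measurable borel"
proof -
  have [measurable]: "f n \<in> borel_measurable borel" for n by fact
  have "(\<lambda>t. (\<lambda>n t. complex_of_real (tent n (t - block_center n)) * f n (block_center n - t)) (block_index t) t)
      \<in> borel_measurable borel"
  proof (rule measurable_compose_countable)
    show "(\<lambda>t. complex_of_real (tent n (t - block_center n)) * f n (block_center n - t)) \<in> borel_measurable borel" for n
      unfolding tent_def by measurable
    show "block_index \<in> borel \<rightarrow>\<^sub>M count_space UNIV"
      unfolding block_index_def[abs_def] by measurable
  qed
  then show ?thesis by (simp add: glue_def[abs_def] Let_def)
qed

lemma norm_glue_le:
  assumes "\<And>n x. norm (f n x) \<le> 1"
  shows "norm (glue f t) \<le> 1"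
  unfolding glue_def Let_def norm_mult
  using assms tent_bounds by (intro mult_le_one) auto

lemma glue_block:
  "block_index t = n \<Longrightarrow>
    glue f t = complex_of_real (tent n (t - block_center n)) * f n (block_center n - t)"
  by (simp add: glue_def)

text \<open>A window of length at most \<open>n / 2\<close> cannot meet two tents. If it reaches
  \<open>(real n + 1)\<^sup>2\<close>, it starts beyond tent \<open>n\<close>; the part before that
  point lies in the gap, where tent \<open>Suc n\<close> vanishes too, so the formula with
  \<open>m = Suc n\<close> holds throughout.\<close>

lemma glue_window:
  fixes T :: real
  assumes n: "n > 0" "2 * T \<le> real n" and x: "(real n)\<^sup>2 \<le> x" "x < (real n + 1)\<^sup>2"
  shows "\<exists>m\<ge>n. \<forall>t\<in>{x..x + T}.
    glue f t = complex_of_real (tent m (t - block_center m)) * f m (block_center m - t)"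
proof (cases "x + T < (real n + 1)\<^sup>2")
  case True
  then show ?thesis using x by (intro exI[of _ n]) (auto intro!: glue_block block_index_eq)
next
  case False
  have "glue f t = complex_of_real (tent (Suc n) (t - block_center (Suc n))) * f (Suc n) (block_center (Suc n) - t)"
    if t: "t \<in> {x..x + T}" for t
  proof (cases "t < (real n + 1)\<^sup>2")
    case True
    have "block_index t = n" using True x t by (intro block_index_eq) auto
    moreover have "tent n (t - block_center n) = 0"
    proof (rule tent_eq_0[OF _ n(1)])
      show "real n \<le> 2 * \<bar>t - block_center n\<bar>"
        using False t n by (simp add: block_center_def power2_eq_square algebra_simps)
    qed
    moreover have "tent (Suc n) (t - block_center (Suc n)) = 0"
      by (rule tent_eq_0) (use True in \<open>auto simp: block_center_def power2_eq_square algebra_simps\<close>)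
    ultimately show ?thesis by (simp add: glue_block)
  next
    case False
    \<comment> \<open>The window is too short to run past the next block.\<close>
    have "t < (real (Suc n) + 1)\<^sup>2"
      using t x n by (simp add: power2_eq_square algebra_simps)
    then show ?thesis using False by (intro glue_block block_index_eq) (auto simp: add.commute)
  qed
  then show ?thesis by (intro exI[of _ "Suc n"]) auto
qed

section \<open>Asymptotics of convolutions and pairings with the glued function\<close>

lemma integral_tail:
  fixes k :: "real \<Rightarrow> complex"
  assumes k: "integrable lborel k" and e: "e > 0"
  shows "\<exists>T\<ge>0. (LINT x|lborel. indicator {..< -T} x * norm (k x)) < e"
proof -
  have [measurable]: "k \<in> borel_measurable borel" using k by auto
  have "((\<lambda>T. LINT x|lborel. indicator {..< -T} x * norm (k x)) \<longlongrightarrow> (LINT (x::real)|lborel. 0)) at_top"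
  proof (rule integral_dominated_convergence_at_top[where w="\<lambda>x. norm (k x)"])
    show "AE x in lborel. ((\<lambda>T. indicator {..< -T} x * norm (k x)) \<longlongrightarrow> 0) at_top"
    proof (intro AE_I2 tendsto_eventually)
      fix x :: real
      show "\<forall>\<^sub>F T in at_top. indicator {..< -T} x * norm (k x) = 0"
        by (rule eventually_mono[OF eventually_ge_at_top[of "- x"]]) (auto simp: indicator_def)
    qed
    show "\<forall>\<^sub>F T in at_top. AE x in lborel. norm (indicator {..< -T} x * norm (k x)) \<le> norm (k x)"
      by (intro always_eventually allI AE_I2) (auto simp: indicator_def)
  qed (use k in auto)
  then have "\<forall>\<^sub>F T in at_top. (LINT x|lborel. indicator {..< -T} x * norm (k x)) < e"
    using order_tendstoD(2)[of _ 0 at_top e] e by simp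
  then obtain T0 where T0: "\<And>T. T \<ge> T0 \<Longrightarrow> (LINT x|lborel. indicator {..< -T} x * norm (k x)) < e"
    by (auto simp: eventually_at_top_linorder)
  show ?thesis by (intro exI[of _ "max 0 T0"] conjI T0) auto
qed

text \<open>Since \<open>k\<close> lives on the negative axis with small tail, mainly the window
  from \<open>x\<close> to \<open>x + T\<close> counts. There \<open>glue f\<close> comes from one
  \<open>f m\<close>; freezing its cutoff at \<open>x\<close> leaves a multiple of an integral of
  \<open>f m\<close> against a translate of \<open>k\<close>.\<close>

lemma glue_convolution_tendsto_0:
  assumes f: "\<And>n. f n \<in> borel_measurable borel" "\<And>n x. norm (f n x) \<le> 1"
    and k: "integrable lborel k" "\<And>x. x \<ge> 0 \<Longrightarrow> k x = 0"
    and ann: "\<And>n y. \<bar>y\<bar> \<le> real n \<Longrightarrow> norm (LINT x|lborel. f n x * k (x + y)) \<le> 1 / (real n + 1)"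
  shows "((\<lambda>x. LINT t|lborel. glue f t * k (x - t)) \<longlongrightarrow> 0) at_top"
proof (rule tendstoI)
  fix e :: real assume e: "e > 0"
  have [measurable]: "f n \<in> borel_measurable borel" "k \<in> borel_measurable borel" for n
    using f(1) k(1) by auto
  obtain T where T: "T \<ge> 0" "(LINT x|lborel. indicator {..< -T} x * norm (k x)) < e / 4"
    using integral_tail[OF k(1), of "e / 4"] e by auto
  define N where "N = (LINT x|lborel. norm (k x))"
  have N: "N \<ge> 0" by (simp add: N_def)
  \<comment> \<open>The terms are the annihilation error and the cost of freezing the cutoff. The
    tail, counted twice, supplies the other \<open>e / 2\<close>.\<close>
  have "(\<lambda>n. 1 / (real n + 1) + 2 * T / real n * N) \<longlonglongrightarrow> 0" by real_asymp
  then have "\<forall>\<^sub>F n in sequentially. 1 / (real n + 1) + 2 * T / real n * N < e / 2"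
    using e by (intro order_tendstoD) auto
  moreover have "\<forall>\<^sub>F n in sequentially. real n \<ge> max 1 (2 * T)" by real_asymp
  ultimately have "\<forall>\<^sub>F n in sequentially. 1 / (real n + 1) + 2 * T / real n * N < e / 2 \<and> real n \<ge> max 1 (2 * T)"
    by eventually_elim simp
  then obtain n0 where n0': "\<And>n. n \<ge> n0 \<Longrightarrow>
      1 / (real n + 1) + 2 * T / real n * N < e / 2 \<and> real n \<ge> max 1 (2 * T)"
    unfolding eventually_sequentially by blast
  have n0: "1 / (real n + 1) + 2 * T / real n * N < e / 2" "n > 0" "2 * T \<le> real n" if "n \<ge> n0" for n
    using n0'[OF that] by auto
  show "\<forall>\<^sub>F x in at_top. dist (LINT t|lborel. glue f t * k (x - t)) 0 < e"
    using eventually_ge_at_top[of "(real n0)\<^sup>2"]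
  proof eventually_elim
    case (elim x)
    then have x0: "x \<ge> 0" using zero_le_power2[of "real n0"] by linarith
    define n where "n = block_index x"
    have x: "(real n)\<^sup>2 \<le> x" "x < (real n + 1)\<^sup>2" unfolding n_def by (rule block_index_bounds[OF x0])+
    have "(real n0)\<^sup>2 < (real n + 1)\<^sup>2" using elim x by linarith
    then have "real n0 < real n + 1" by (rule power_less_imp_less_base) simp
    then have n: "n \<ge> n0" by linarith
    obtain m where m: "m \<ge> n" and gm: "\<And>t. t \<in> {x..x + T} \<Longrightarrow>
        glue f t = complex_of_real (tent m (t - block_center m)) * f m (block_center m - t)"
      using glue_window[OF n0(2)[OF n] n0(3)[OF n] x, of f] by blast
    have m0: "m \<ge> n0" "m > 0" using m n n0(2) by auto
    define c where "c = complex_of_real (tent m (x - block_center m))"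
    define G where "G t = c * f m (block_center m - t)" for t
    have c1: "norm c \<le> 1" using tent_bounds[of m] by (simp add: c_def)
    have [measurable]: "G \<in> borel_measurable borel" "glue f \<in> borel_measurable borel"
      unfolding G_def[abs_def] by measurable
    have G1: "norm (G t) \<le> 1" for t
      unfolding G_def norm_mult using c1 f(2) by (intro mult_le_one) auto
    note F1 = norm_glue_le[of f, OF f(2)]
    have ikx: "integrable lborel (\<lambda>t. k (x - t))" by (rule integrable_reflect[OF k(1)])
    have iF: "integrable lborel (\<lambda>t. glue f t * k (x - t))" and iG: "integrable lborel (\<lambda>t. G t * k (x - t))"
      using F1 G1 by (auto intro!: integrable_bounded_mult[where C=1] ikx)
    have "(LINT t|lborel. G t * k (x - t)) = c * (LINT t|lborel. f m (block_center m - t) * k (x - t))"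
      by (simp add: G_def mult.assoc)
    also have "(LINT t|lborel. f m (block_center m - t) * k (x - t)) =
        (LINT u|lborel. f m u * k (u + (x - block_center m)))"
      using integral_reflect[of "\<lambda>u. f m u * k (u + (x - block_center m))" "block_center m"]
      by (simp add: algebra_simps)
    finally have IG: "(LINT t|lborel. G t * k (x - t)) = c * (LINT u|lborel. f m u * k (u + (x - block_center m)))" .
    have 1: "norm (LINT t|lborel. G t * k (x - t)) \<le> 1 / (real m + 1)"
    proof (cases "\<bar>x - block_center m\<bar> \<le> real m")
      case True
      then show ?thesis
        unfolding IG norm_mult using mult_mono[OF c1 ann[OF True]] by simp
    next
      case False
      then have "c = 0" unfolding c_def by (simp add: tent_eq_0 m0)
      then show ?thesis unfolding IG by simp
    qed
    \<comment> \<open>Left of \<open>x\<close> the kernel vanishes, on the window the Lipschitz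
      bound applies, and beyond it both functions are merely bounded by 1.\<close>
    have pt: "norm (glue f t * k (x - t) - G t * k (x - t)) \<le>
        2 * T / real m * norm (k (x - t)) + 2 * (indicator {..< -T} (x - t) * norm (k (x - t)))" for t
    proof -
      consider "t \<le> x" | "t \<in> {x..x + T}" | "t > x + T" by force
      then show ?thesis
      proof cases
        case 1
        then show ?thesis using k(2)[of "x - t"] by simp
      next
        case 2
        have "norm (glue f t - G t) = \<bar>tent m (t - block_center m) - tent m (x - block_center m)\<bar> * norm (f m (block_center m - t))"
          unfolding gm[OF 2] G_def c_def left_diff_distrib[symmetric] norm_mult
          by (simp flip: of_real_diff)
        also have "\<dots> \<le> (2 * \<bar>(t - block_center m) - (x - block_center m)\<bar> / real m) * 1"
          by (intro mult_mono tent_lipschitz f) auto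
        also have "\<dots> \<le> 2 * T / real m" using 2 by (auto intro!: divide_right_mono)
        finally have "norm (glue f t - G t) * norm (k (x - t)) \<le> 2 * T / real m * norm (k (x - t))"
          by (intro mult_right_mono) auto
        then show ?thesis unfolding left_diff_distrib[symmetric] norm_mult
          by (rule order_trans) simp
      next
        case 3
        have "norm (glue f t - G t) \<le> 2" using norm_triangle_ineq4[of "glue f t" "G t"] F1[of t] G1[of t] by linarith
        then have "norm (glue f t - G t) * norm (k (x - t)) \<le> 2 * norm (k (x - t))"
          by (intro mult_right_mono) auto
        moreover have "0 \<le> 2 * T / real m * norm (k (x - t))" using T(1) by simp
        ultimately show ?thesis unfolding left_diff_distrib[symmetric] norm_mult using 3
          by (simp add: indicator_def)
      qed
    qed
    have itail: "integrable lborel (\<lambda>t. indicator {..< -T} (x - t) * norm (k (x - t)))"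
      by (rule Bochner_Integration.integrable_bound[OF integrable_norm[OF ikx]])
         (auto simp: indicator_def)
    have "norm (LINT t|lborel. glue f t * k (x - t) - G t * k (x - t)) \<le>
        (LINT t|lborel. norm (glue f t * k (x - t) - G t * k (x - t)))"
      by (rule integral_norm_bound)
    also have "\<dots> \<le> (LINT t|lborel. 2 * T / real m * norm (k (x - t)) + 2 * (indicator {..< -T} (x - t) * norm (k (x - t))))"
      by (rule integral_mono) (use iF iG ikx itail pt in auto)
    also have "\<dots> = 2 * T / real m * (LINT t|lborel. norm (k (x - t))) + 2 * (LINT t|lborel. indicator {..< -T} (x - t) * norm (k (x - t)))"
      using ikx itail by simp
    also have "(LINT t|lborel. norm (k (x - t))) = N"
      unfolding N_def by (rule integral_reflect)
    also have "(LINT t|lborel. indicator {..< -T} (x - t) * norm (k (x - t))) = (LINT x|lborel. indicator {..< -T} x * norm (k x))"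
      by (rule integral_reflect)
    finally have 2: "norm (LINT t|lborel. glue f t * k (x - t) - G t * k (x - t)) < 2 * T / real m * N + e / 2"
      using T(2) by simp
    have "(LINT t|lborel. glue f t * k (x - t)) =
        (LINT t|lborel. glue f t * k (x - t) - G t * k (x - t)) + (LINT t|lborel. G t * k (x - t))"
      using iF iG by simp
    then have "norm (LINT t|lborel. glue f t * k (x - t)) \<le>
        norm (LINT t|lborel. glue f t * k (x - t) - G t * k (x - t)) + norm (LINT t|lborel. G t * k (x - t))"
      by (simp only: norm_triangle_ineq)
    then have "norm (LINT t|lborel. glue f t * k (x - t)) < (2 * T / real m * N + e / 2) + 1 / (real m + 1)"
      using 1 2 by linarith
    with n0(1)[OF m0(1)] show ?case by simp
  qed
qed

text \<open>Shifting by \<open>M\<close> moves the reflected \<open>g\<close> onto the half line,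
  making it an admissible test function. At \<open>block_center n - M\<close> the two reflections
  cancel, and the pairing becomes the integral of \<open>f n\<close> against \<open>g\<close>,
  damped by a tent close to 1 on the support of \<open>g\<close>.\<close>

lemma glue_pairing_tendsto:
  assumes f: "\<And>n. f n \<in> borel_measurable borel" "\<And>n x. norm (f n x) \<le> 1"
    and g: "integrable lborel g" "\<And>x. \<bar>x\<bar> > M \<Longrightarrow> g x = 0" and M: "M \<ge> 0"
    and lim: "(\<lambda>n. LINT x|lborel. f n x * g x) \<longlonglongrightarrow> L"
  shows "(\<lambda>n. S_fun (\<lambda>t. g (M - t)) (glue f) (block_center n - M)) \<longlonglongrightarrow> L"
proof -
  have [measurable]: "f n \<in> borel_measurable borel" "g \<in> borel_measurable borel" for n
    using f(1) g(1) by auto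
  define N where "N = (LINT x|lborel. norm (g x))"
  have S: "S_fun (\<lambda>t. g (M - t)) (glue f) s = (LINT u|lborel. glue f (M + s - u) * g u)" for s
  proof -
    have "S_fun (\<lambda>t. g (M - t)) (glue f) s = (LINT t|lborel. glue f (t + s) * g (M - t))"
      unfolding S_fun_shift set_lebesgue_integral_def
      by (intro Bochner_Integration.integral_cong) (use g(2) in \<open>auto simp: indicator_def\<close>)
    also have "\<dots> = (LINT u|lborel. glue f (M + s - u) * g u)"
      using integral_reflect[of "\<lambda>u. glue f (M + s - u) * g u" M] by (simp add: add.commute)
    finally show ?thesis .
  qed
  have bound: "norm (S_fun (\<lambda>t. g (M - t)) (glue f) (block_center n - M) - (LINT x|lborel. f n x * g x)) \<le> 2 * M / real n * N"
    if n: "real n \<ge> M" "n > 0" for n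
  proof -
    have eq: "glue f (block_center n - u) * g u = complex_of_real (tent n u) * (f n u * g u)" for u
    proof (cases "\<bar>u\<bar> \<le> M")
      case True
      \<comment> \<open>The centre lies \<open>n\<close> above the left end of its block and
        \<open>n + 1\<close> below the right end, so \<open>\<bar>u\<bar> \<le> M \<le> n\<close>
        stays inside.\<close>
      have "block_index (block_center n - u) = n"
        using True n by (intro block_index_eq) (auto simp: block_center_def power2_eq_square algebra_simps)
      then have "glue f (block_center n - u) = complex_of_real (tent n (- u)) * f n u"
        by (simp add: glue_block)
      then show ?thesis by (simp add: tent_def)
    next
      case False
      then show ?thesis using g(2)[of u] by simp
    qed
    have ifg: "integrable lborel (\<lambda>x. f n x * g x)"
      by (rule integrable_bounded_mult[OF g(1), where C=1]) (use f in auto)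
    have it: "integrable lborel (\<lambda>u. complex_of_real (tent n u) * (f n u * g u))"
      by (rule integrable_bounded_mult[OF ifg, where C=1])
         (use tent_bounds[of n] in \<open>auto simp: tent_def[abs_def]\<close>)
    have "norm (complex_of_real (tent n u) * (f n u * g u) - f n u * g u) \<le> 2 * M / real n * norm (g u)" for u
    proof (cases "\<bar>u\<bar> \<le> M")
      case True
      \<comment> \<open>The peak value \<open>tent n 0\<close> is 1, so the damping error is an
        increment of the tent.\<close>
      have "complex_of_real (tent n u) * (f n u * g u) - f n u * g u = complex_of_real (tent n u - tent n 0) * (f n u * g u)"
        by (simp add: tent_def left_diff_distrib)
      then have "norm (complex_of_real (tent n u) * (f n u * g u) - f n u * g u) = \<bar>tent n u - tent n 0\<bar> * (norm (f n u) * norm (g u))"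
        by (simp only: norm_mult norm_of_real)
      also have "\<dots> \<le> (2 * M / real n) * (1 * norm (g u))"
      proof (intro mult_mono)
        have "\<bar>tent n u - tent n 0\<bar> \<le> 2 * \<bar>u - 0\<bar> / real n" by (rule tent_lipschitz)
        also have "\<dots> \<le> 2 * M / real n" using True by (intro divide_right_mono) auto
        finally show "\<bar>tent n u - tent n 0\<bar> \<le> 2 * M / real n" .
      qed (use f M in auto)
      finally show ?thesis by simp
    next
      case False
      then show ?thesis using g(2)[of u] by simp
    qed
    then have "(LINT u|lborel. norm (complex_of_real (tent n u) * (f n u * g u) - f n u * g u)) \<le>
        (LINT u|lborel. 2 * M / real n * norm (g u))"
      using it ifg g(1) by (intro integral_mono) auto
    also have "\<dots> = 2 * M / real n * N" by (simp add: N_def)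
    finally have "norm (LINT u|lborel. complex_of_real (tent n u) * (f n u * g u) - f n u * g u) \<le> 2 * M / real n * N"
      by (rule order_trans[OF integral_norm_bound])
    then show ?thesis unfolding S using it ifg by (simp add: eq)
  qed
  have "\<forall>\<^sub>F n in sequentially. real n \<ge> M \<and> n > 0"
    by (intro eventually_conj eventually_gt_at_top) real_asymp
  then have "\<forall>\<^sub>F n in sequentially. norm (S_fun (\<lambda>t. g (M - t)) (glue f) (block_center n - M) - (LINT x|lborel. f n x * g x)) \<le> 2 * M / real n * N"
    by eventually_elim (use bound in blast)
  moreover have "(\<lambda>n. 2 * M / real n * N) \<longlonglongrightarrow> 0" by real_asymp
  ultimately have "(\<lambda>n. S_fun (\<lambda>t. g (M - t)) (glue f) (block_center n - M) - (LINT x|lborel. f n x * g x)) \<longlonglongrightarrow> 0"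
    by (rule Lim_null_comparison)
  from tendsto_add[OF this lim] show ?thesis by simp
qed

text \<open>Truncations of \<open>g\<close> converge to \<open>g\<close> in L1, so they cannot all
  lie in the closed set \<open>I\<close>. Compact support is what lets the test function fit inside
  a block and onto the half line.\<close>

lemma closed_ideal_L1_missing_compact_support:
  assumes I: "closed_ideal_L1 I" and g: "integrable lborel g" "g \<notin> I"
  shows "\<exists>h M. integrable lborel h \<and> h \<notin> I \<and> M \<ge> 0 \<and> (\<forall>x. \<bar>x\<bar> > M \<longrightarrow> h x = 0)"
proof -
  define h where "h n x = indicator {- real n..real n} x *\<^sub>R g x" for n x
  have ih: "integrable lborel (h n)" for n unfolding h_def[abs_def] using g(1) by (intro integrable_mult_indicator) auto
  have "\<exists>n. h n \<notin> I"
  proof (rule ccontr)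
    assume "\<not> ?thesis"
    then have hI: "h n \<in> I" for n by blast
    have "g \<in> I"
    proof (rule closed_ideal_L1_closed[OF I g(1)])
      fix e :: real assume e: "e > 0"
      have "(\<lambda>n. LINT x|lborel. norm (g x - h n x)) \<longlonglongrightarrow> (LINT (x::real)|lborel. 0)"
      proof (rule integral_dominated_convergence[where w="\<lambda>x. norm (g x)"])
        show "AE x in lborel. (\<lambda>n. norm (g x - h n x)) \<longlonglongrightarrow> 0"
        proof (intro AE_I2 tendsto_eventually)
          fix x :: real
          have "\<forall>\<^sub>F n in sequentially. \<bar>x\<bar> \<le> real n" by real_asymp
          then show "\<forall>\<^sub>F n in sequentially. norm (g x - h n x) = 0"
            by eventually_elim (auto simp: h_def indicator_def)
        qed
        show "AE x in lborel. norm (norm (g x - h n x)) \<le> norm (g x)" for n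
          by (auto simp: h_def indicator_def)
      qed (use g(1) ih in auto)
      then have "\<forall>\<^sub>F n in sequentially. (LINT x|lborel. norm (g x - h n x)) < e"
        using order_tendstoD(2)[of _ 0 sequentially e] e by simp
      then obtain n where "(LINT x|lborel. norm (g x - h n x)) < e"
        by (auto simp: eventually_sequentially)
      with hI show "\<exists>f\<in>I. (LINT x|lborel. norm (g x - f x)) < e" by blast
    qed
    with g(2) show False ..
  qed
  then obtain n where "h n \<notin> I" ..
  moreover have "h n x = 0" if "\<bar>x\<bar> > real n" for x using that by (auto simp: h_def indicator_def)
  ultimately show ?thesis using ih[of n] by (intro exI[of _ "h n"] exI[of _ "real n"]) auto
qed

section \<open>A counterexample from a proper closed ideal\<close>

lemma not_in_closed_ideal_L1_imp_counterexample:
  assumes \<phi>: "set_integrable lborel {0..} \<phi>"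
    and I: "closed_ideal_L1 I" "phi_star \<phi> \<in> I" and g: "integrable lborel g" "g \<notin> I"
  shows "\<exists>F. Linf_Rplus F \<and> (S_fun \<phi> F \<longlongrightarrow> 0) at_top \<and> \<not> K_conv F 0"
proof -
  obtain h M where h: "integrable lborel h" "h \<notin> I" and M: "M \<ge> 0" and h0: "\<And>x. \<bar>x\<bar> > M \<Longrightarrow> h x = 0"
    using closed_ideal_L1_missing_compact_support[OF I(1) g] by blast
  have "\<not> (\<forall>e>0. \<exists>f\<in>I. (LINT x|lborel. norm (h x - f x)) < e)"
    using closed_ideal_L1_closed[OF I(1) h(1)] h(2) by blast
  then obtain d where d: "d > 0" "\<And>f. f \<in> I \<Longrightarrow> d \<le> (LINT x|lborel. norm (h x - f x))"
    by (auto simp: not_less)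
  \<comment> \<open>Shift range \<open>n\<close> grows while the tolerance
    \<open>1 / (n + 1)\<close> shrinks, matching the assumptions on the sequence to be
    glued.\<close>
  define P where "P n f \<longleftrightarrow> f \<in> borel_measurable borel \<and> (\<forall>x. norm (f x) \<le> 1) \<and>
    (\<forall>y. \<bar>y\<bar> \<le> real n \<longrightarrow> norm (LINT x|lborel. f x * phi_star \<phi> (x + y)) < 1 / (real n + 1)) \<and>
    norm ((LINT x|lborel. f x * h x) - complex_of_real d) < 1 / (real n + 1)" for n f
  have "\<exists>f. P n f" for n
    using almost_annihilator[OF I h(1) d, of "1 / (real n + 1)" "real n"] unfolding P_def by auto
  then obtain f where "\<And>n. P n (f n)" by metis
  then have f: "\<And>n. f n \<in> borel_measurable borel" "\<And>n x. norm (f n x) \<le> 1"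
    "\<And>n y. \<bar>y\<bar> \<le> real n \<Longrightarrow> norm (LINT x|lborel. f n x * phi_star \<phi> (x + y)) < 1 / (real n + 1)"
    "\<And>n. norm ((LINT x|lborel. f n x * h x) - complex_of_real d) < 1 / (real n + 1)"
    unfolding P_def by simp_all
  define F where "F = glue f"
  have mF[measurable]: "F \<in> borel_measurable borel" unfolding F_def using f(1) by measurable
  have F1: "norm (F t) \<le> 1" for t unfolding F_def using f(2) by (rule norm_glue_le)
  have LF: "Linf_Rplus F"
    unfolding Linf_Rplus_def set_borel_measurable_def using F1 by (auto intro!: exI[of _ 1])
  have "((\<lambda>x. LINT t|lborel. F t * phi_star \<phi> (x - t)) \<longlongrightarrow> 0) at_top"
    unfolding F_def
    by (rule glue_convolution_tendsto_0[OF f(1,2) integrable_phi_star[OF \<phi>] _ less_imp_le[OF f(3)]])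
       (auto simp: phi_star_def)
  moreover have "\<forall>\<^sub>F x in at_top. S_fun \<phi> F x = (LINT t|lborel. F t * phi_star \<phi> (x - t))"
    by (rule eventually_mono[OF eventually_ge_at_top[of 0]]) (rule S_fun_eq_convolution[OF LF mF _ \<phi>], simp_all)
  ultimately have "(S_fun \<phi> F \<longlongrightarrow> 0) at_top"
    by (simp add: tendsto_cong)
  moreover have "\<not> K_conv F 0"
  proof
    assume K: "K_conv F 0"
    have "L1_Rplus (\<lambda>t. h (M - t))"
      unfolding L1_Rplus_def set_integrable_def
      using integrable_reflect[OF h(1), of M] by (intro integrable_mult_indicator) auto
    with K have "(S_fun (\<lambda>t. h (M - t)) F \<longlongrightarrow> 0) at_top" by (auto simp: K_conv_iff_S_fun)
    \<comment> \<open>Along these points, which tend to infinity, the pairings tend to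
      \<open>d\<close>, not to 0.\<close>
    moreover have "filterlim (\<lambda>n. block_center n - M) at_top sequentially"
      unfolding block_center_def by real_asymp
    ultimately have "(\<lambda>n. S_fun (\<lambda>t. h (M - t)) F (block_center n - M)) \<longlonglongrightarrow> 0"
      by (rule filterlim_compose)
    moreover have "(\<lambda>n. S_fun (\<lambda>t. h (M - t)) F (block_center n - M)) \<longlonglongrightarrow> complex_of_real d"
      unfolding F_def
    proof (rule glue_pairing_tendsto[OF f(1,2) h(1) h0 M])
      have "(\<lambda>n. (LINT x|lborel. f n x * h x) - complex_of_real d) \<longlonglongrightarrow> 0"
      proof (rule Lim_null_comparison)
        show "\<forall>\<^sub>F n in sequentially. norm ((LINT x|lborel. f n x * h x) - complex_of_real d) \<le> 1 / (real n + 1)"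
          using f(4) by (simp add: less_imp_le)
        show "(\<lambda>n. 1 / (real n + 1)) \<longlonglongrightarrow> 0" by real_asymp
      qed
      then show "(\<lambda>n. LINT x|lborel. f n x * h x) \<longlonglongrightarrow> complex_of_real d"
        by (rule LIM_zero_cancel)
    qed
    ultimately have "complex_of_real d = 0" using LIMSEQ_unique by blast
    then show False using d(1) by simp
  qed
  ultimately show ?thesis using LF by blast
qed

section \<open>The two implications of the equivalence\<close>

theorem theorem4p2:
  fixes \<phi> :: "real \<Rightarrow> complex"
  assumes "set_integrable lborel {0..} \<phi>"
    and "(LINT x:{0..}|lborel. \<phi> x) = 1"
  shows "equivalent_methods (S_dom \<phi>) (S_val \<phi>) K_dom K_val \<longleftrightarrow>
         closed_ideal_generated (phi_star \<phi>) = L1_R"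
proof
  assume eq: "equivalent_methods (S_dom \<phi>) (S_val \<phi>) K_dom K_val"
  have "g \<in> I" if I: "closed_ideal_L1 I" "phi_star \<phi> \<in> I" and g: "g \<in> L1_R" for I g
  proof (rule ccontr)
    assume "g \<notin> I"
    with g obtain F where F: "Linf_Rplus F" "(S_fun \<phi> F \<longlongrightarrow> 0) at_top" "\<not> K_conv F 0"
      using not_in_closed_ideal_L1_imp_counterexample[OF assms(1) I] by (auto simp: L1_R_def)
    then have "F \<in> S_dom \<phi>" by (auto simp: S_dom_def)
    then have "F \<in> K_dom" "K_val F = S_val \<phi> F"
      using eq by (auto simp: equivalent_methods_def stronger_def)
    then obtain \<alpha> where "K_conv F \<alpha>" by (auto simp: K_dom_def)
    \<comment> \<open>Equivalence also matches the values, so any weak* limit of \<open>F\<close>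
      must be its S-limit 0.\<close>
    then have "\<alpha> = 0"
      using K_val_eq[OF assms] S_val_eq[OF F(2)] \<open>K_val F = S_val \<phi> F\<close> by simp
    with \<open>K_conv F \<alpha>\<close> F(3) show False by simp
  qed
  \<comment> \<open>The whole algebra is itself among the intersected ideals, so the intersection is
    taken over a nonempty family.\<close>
  moreover have "closed_ideal_generated (phi_star \<phi>) \<subseteq> L1_R"
    unfolding closed_ideal_generated_def
    using closed_ideal_L1_L1_R integrable_phi_star[OF assms(1)] by (auto simp: L1_R_def)
  ultimately show "closed_ideal_generated (phi_star \<phi>) = L1_R"
    unfolding closed_ideal_generated_def by blast
next
  assume gen: "closed_ideal_generated (phi_star \<phi>) = L1_R"
  have "stronger K_dom K_val (S_dom \<phi>) (S_val \<phi>)"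
    unfolding stronger_def
  proof (intro conjI subsetI ballI)
    fix f assume "f \<in> S_dom \<phi>"
    then obtain \<alpha> where f: "Linf_Rplus f" "(S_fun \<phi> f \<longlongrightarrow> \<alpha>) at_top" by (auto simp: S_dom_def)
    have K: "K_conv f \<alpha>" by (rule S_limit_imp_K_conv[OF assms gen f])
    then show "f \<in> K_dom" using f(1) by (auto simp: K_dom_def)
    show "K_val f = S_val \<phi> f" using K_val_eq[OF assms K] S_val_eq[OF f(2)] by simp
  qed
  then show "equivalent_methods (S_dom \<phi>) (S_val \<phi>) K_dom K_val"
    using S_stronger_than_K[OF assms] by (simp add: equivalent_methods_def)
qed

end
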